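(* Let $l,\alpha,k>0$. Let $\mathbf{M}\in\mathrm{wp}(4,8,\mathbb{C})$, $0\neq u\in L^2[-l,l]$, and $\lambda\in\mathbb{C}$. Then $\mathcal{K}_{\mathbf{M}}[u]=\lambda\cdot u$ if and only if $\lambda\neq 0$ and there exists $\mathbf{0}\neq\mathbf{c}\in\mathrm{gl}(4,1,\mathbb{C})$ such that $u=\mathbf{y}_\lambda^T\mathbf{c}$ and $$\left[\mathbf{G}_{\mathbf{M}}\left\{\mathbf{X}_\lambda(l)-\mathbf{X}_\lambda(-l)\right\}+\mathbf{X}_\lambda(l)\right]\mathbf{c}=\mathbf{0}.$$ Moreover, $\mathcal{K}_{\mathbf{Q}}[u]=\lambda\cdot u$ if and only if $\lambda\neq 0$ and there exists $\mathbf{0}\neq\mathbf{c}\in\mathrm{gl}(4,1,\mathbb{C})$ such that $u=\mathbf{y}_\lambda^T\mathbf{c}$ and $\mathbf{X}_\lambda(l)\cdot\mathbf{c}=\mathbf{0}$.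
   Context: Fix $l,\alpha,k>0$. $\mathrm{gl}(m,n,\mathbb{C})$ is the set of complex $m\times n$ matrices, $\mathrm{gl}(n,\mathbb{C})=\mathrm{gl}(n,n,\mathbb{C})$; $L^2[-l,l]$ is the Hilbert space of complex-valued square-integrable functions (equalities in it are a.e.). Matrices. $\omega_j=e^{\sqrt{-1}\,\frac{\pi}{4}(2j-1)}$ ($j\in\mathbb{Z}$), $\mathbf{\Omega}=\mathrm{diag}(\omega_1,\omega_2,\omega_3,\omega_4)$, $\mathcal{E}=\mathrm{diag}(1,-1,-1,1)$, and $\mathbf{L}^2=\begin{pmatrix}0&0&1&0\\0&0&0&1\\1&0&0&0\\0&1&0&0\end{pmatrix}$. Let $\mathbf{y}(x)=(e^{\omega_1\alpha x},e^{\omega_2\alpha x},e^{\omega_3\alpha x},e^{\omega_4\alpha x})^T$ and $\mathbf{W}(x)=\left((\omega_q\alpha)^{p-1}e^{\omega_q\alpha x}\right)_{1\le p,q\le 4}$ (row index $p$, column index $q$), which is invertible for every $x$. Well-posedness. Write $\mathbf{M}=(\mathbf{M}^-\ \mathbf{M}^+)\in\mathrm{gl}(4,8,\mathbb{C})$ with $\mathbf{M}^\pm\in\mathrm{gl}(4,\mathbb{C})$. For $u\in C^3[-l,l]$, $\mathcal{B}[u]=(u(-l),u'(-l),u''(-l),u'''(-l),u(l),u'(l),u''(l),u'''(l))^T$. $\mathbf{M}$ is well-posed if $u=0$ is the only solution of $u^{(4)}+\alpha^4u=0$ on $[-l,l]$ with $\mathbf{M}\cdot\mathcal{B}[u]=\mathbf{0}$;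 $\mathrm{wp}(4,8,\mathbb{C})$ is the set of well-posed matrices. Put $\widetilde{\mathbf{M}}^-=\mathbf{M}^-\mathbf{W}(-l)$, $\widetilde{\mathbf{M}}^+=\mathbf{M}^+\mathbf{W}(l)$, $\widetilde{\mathbf{M}}=\widetilde{\mathbf{M}}^-+\widetilde{\mathbf{M}}^+$ (invertible when $\mathbf{M}$ is well-posed). For well-posed $\mathbf{M}$ let $\mathbf{G}_{\mathbf{M}}^\pm=\widetilde{\mathbf{M}}^{-1}\widetilde{\mathbf{M}}^\pm\mathbf{\Omega}\mathbf{L}^2$. Operator. The Green's function is $G_{\mathbf{M}}(x,\xi)=\frac{\alpha}{4k}\mathbf{y}(x)^T\mathbf{G}_{\mathbf{M}}^+\mathbf{y}(\xi)$ if $x\le\xi$ and $-\frac{\alpha}{4k}\mathbf{y}(x)^T\mathbf{G}_{\mathbf{M}}^-\mathbf{y}(\xi)$ if $\xi\le x$, and $\mathcal{K}_{\mathbf{M}}:L^2[-l,l]\to L^2[-l,l]$ is $\mathcal{K}_{\mathbf{M}}[w](x)=\int_{-l}^lG_{\mathbf{M}}(x,\xi)w(\xi)\,d\xi$. The matrix $\mathbf{Q}=\left(\begin{array}{cccc|cccc}0&\alpha^2&-\sqrt2\alpha&1&0&0&0&0\\ \sqrt2\alpha^3&-\alpha^2&0&1&0&0&0&0\\0&0&0&0&0&\alpha^2&\sqrt2\alpha&1\\0&0&0&0&-\sqrt2\alpha^3&-\alpha^2&0&1\end{array}\right)$ is well-posed. For $\mathbf{M}\in\mathrm{wp}(4,8,\mathbb{C})$,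 the $4\times4$ matrix $\mathbf{G}_{\mathbf{M}}$ (not to be confused with the function $G_{\mathbf{M}}$) is $\mathbf{G}_{\mathbf{M}}=(\mathbf{G}_{\mathbf{M}}^+-\mathbf{G}_{\mathbf{Q}}^+)(\mathbf{\Omega}\mathbf{L}^2)^{-1}\mathcal{E}$. $\lambda$-dependent objects. For $\lambda\in\mathbb{C}\setminus\{0,1/k\}$, $\kappa=\chi(\lambda)$ is the unique complex number with $\kappa^4=1-1/(\lambda k)$ and $0\le\operatorname{Arg}\kappa<\pi/2$. For $\lambda\ne0$: $y_{\lambda,j}(x)=\frac{x^{j-1}}{(j-1)!}$ if $\lambda=1/k$, and $y_{\lambda,j}(x)=e^{\omega_j\kappa\alpha x}$ if $\lambda\ne1/k$ ($j=1,2,3,4$); $\mathbf{y}_\lambda=(y_{\lambda,1},y_{\lambda,2},y_{\lambda,3},y_{\lambda,4})^T$; $\mathbf{W}_\lambda(x)=\left(y_{\lambda,q}^{(p-1)}(x)\right)_{1\le p,q\le4}$. For $0\ne\lambda\in\mathbb{C}$ and $x\in\mathbb{R}$, $$\mathbf{X}_\lambda(x)=\mathrm{diag}(0,1,1,0)\mathbf{W}(-x)^{-1}\mathbf{W}_\lambda(-x)+\mathrm{diag}(1,0,0,1)\mathbf{W}(x)^{-1}\mathbf{W}_\lambda(x).$$ *)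

theory Defs
  imports "HOL-Analysis.Analysis"
begin

section \<open>Constant matrices\<close>

text \<open>
  The numeral type \<open>4\<close> is arithmetic modulo 4, so its elements 1, 2, 3, 4 satisfy \<open>4 = 0\<close>.
  The natural number \<open>pos j\<close> recovers the index 1, 2, 3, 4; this is also the order in which
  \<^const>\<open>vector\<close> fills in the entries of a list.
\<close>

definition pos :: "4 \<Rightarrow> nat" where
  "pos j = (if j = 1 then 1 else if j = 2 then 2 else if j = 3 then 3 else 4)"

definition omega :: "int \<Rightarrow> complex" where
  "omega j = exp (\<i> * of_real (pi / 4 * (2 * of_int j - 1)))"

definition diag :: "complex^4 \<Rightarrow> complex^4^4" where
  "diag d = (\<chi> i j. if i = j then d $ i else 0)"

definition Omega :: "complex^4^4" where
  "Omega = diag (\<chi> j. omega (int (pos j)))"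

definition Eps :: "complex^4^4" where
  "Eps = diag (vector [1, -1, -1, 1])"

definition Lsq :: "complex^4^4" where
  "Lsq = vector
     [vector [0, 0, 1, 0],
      vector [0, 0, 0, 1],
      vector [1, 0, 0, 0],
      vector [0, 1, 0, 0]]"

text \<open>
  The bilinear pairing \<open>v\<^sup>T w\<close>, without complex conjugation. The library's inner product on
  \<^typ>\<open>complex^4\<close> is the real one, hence not usable here.
\<close>

definition tdot :: "complex^4 \<Rightarrow> complex^4 \<Rightarrow> complex" where
  "tdot v w = (\<Sum>i\<in>UNIV. v $ i * w $ i)"

text \<open>
  A 4 by 8 matrix is written with columns indexed by \<^typ>\<open>4 + 4\<close>: the columns \<open>Inl j\<close> form the
  left block and the columns \<open>Inr j\<close> the right block.
\<close>

definition left_block :: "complex^(4 + 4)^4 \<Rightarrow> complex^4^4" where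
  "left_block M = (\<chi> i j. M $ i $ Inl j)"

definition right_block :: "complex^(4 + 4)^4 \<Rightarrow> complex^4^4" where
  "right_block M = (\<chi> i j. M $ i $ Inr j)"

definition join_blocks :: "complex^4^4 \<Rightarrow> complex^4^4 \<Rightarrow> complex^(4 + 4)^4" where
  "join_blocks A B = (\<chi> i s. case s of Inl j \<Rightarrow> A $ i $ j | Inr j \<Rightarrow> B $ i $ j)"


section \<open>Well-posed boundary matrices\<close>

text \<open>
  Iterated derivative of a complex-valued function of a real variable, taken within \<open>S\<close>
  (one-sided at the endpoints when \<open>S\<close> is a compact interval).
\<close>

fun nderiv :: "real set \<Rightarrow> nat \<Rightarrow> (real \<Rightarrow> complex) \<Rightarrow> real \<Rightarrow> complex" where
  "nderiv S 0 u x = u x"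
| "nderiv S (Suc n) u x = vector_derivative (nderiv S n u) (at x within S)"

definition C_on :: "nat \<Rightarrow> real set \<Rightarrow> (real \<Rightarrow> complex) \<Rightarrow> bool" where
  "C_on n S u \<longleftrightarrow>
     (\<forall>p<n. \<forall>x\<in>S. nderiv S p u differentiable (at x within S)) \<and>
     continuous_on S (nderiv S n u)"

definition bvals :: "real \<Rightarrow> (real \<Rightarrow> complex) \<Rightarrow> complex^(4 + 4)" where
  "bvals l u = (\<chi> s. case s of
       Inl j \<Rightarrow> nderiv {-l..l} (pos j - 1) u (-l)
     | Inr j \<Rightarrow> nderiv {-l..l} (pos j - 1) u l)"

definition well_posed :: "real \<Rightarrow> real \<Rightarrow> complex^(4 + 4)^4 \<Rightarrow> bool" where
  "well_posed l \<alpha> M \<longleftrightarrow>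
     (\<forall>u. C_on 4 {-l..l} u \<longrightarrow>
          (\<forall>x\<in>{-l..l}. nderiv {-l..l} 4 u x + of_real (\<alpha> ^ 4) * u x = 0) \<longrightarrow>
          M *v bvals l u = 0 \<longrightarrow>
          (\<forall>x\<in>{-l..l}. u x = 0))"

definition Qmat :: "real \<Rightarrow> complex^(4 + 4)^4" where
  "Qmat \<alpha> = join_blocks
     (vector
       [vector [0, of_real (\<alpha>\<^sup>2), - of_real (sqrt 2 * \<alpha>), 1],
        vector [of_real (sqrt 2 * \<alpha> ^ 3), - of_real (\<alpha>\<^sup>2), 0, 1],
        vector [0, 0, 0, 0],
        vector [0, 0, 0, 0]])
     (vector
       [vector [0, 0, 0, 0],
        vector [0, 0, 0, 0],
        vector [0, of_real (\<alpha>\<^sup>2), of_real (sqrt 2 * \<alpha>), 1],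
        vector [- of_real (sqrt 2 * \<alpha> ^ 3), - of_real (\<alpha>\<^sup>2), 0, 1]])"


section \<open>Green's function and the integral operator\<close>

definition yvec :: "real \<Rightarrow> real \<Rightarrow> complex^4" where
  "yvec \<alpha> x = (\<chi> j. exp (omega (int (pos j)) * of_real \<alpha> * of_real x))"

definition Wmat :: "real \<Rightarrow> real \<Rightarrow> complex^4^4" where
  "Wmat \<alpha> x = (\<chi> p q. (omega (int (pos q)) * of_real \<alpha>) ^ (pos p - 1) *
                       exp (omega (int (pos q)) * of_real \<alpha> * of_real x))"

definition Mt_minus :: "real \<Rightarrow> real \<Rightarrow> complex^(4 + 4)^4 \<Rightarrow> complex^4^4" where
  "Mt_minus l \<alpha> M = left_block M ** Wmat \<alpha> (-l)"

definition Mt_plus :: "real \<Rightarrow> real \<Rightarrow> complex^(4 + 4)^4 \<Rightarrow> complex^4^4" where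
  "Mt_plus l \<alpha> M = right_block M ** Wmat \<alpha> l"

definition Mt :: "real \<Rightarrow> real \<Rightarrow> complex^(4 + 4)^4 \<Rightarrow> complex^4^4" where
  "Mt l \<alpha> M = Mt_minus l \<alpha> M + Mt_plus l \<alpha> M"

definition G_minus :: "real \<Rightarrow> real \<Rightarrow> complex^(4 + 4)^4 \<Rightarrow> complex^4^4" where
  "G_minus l \<alpha> M = matrix_inv (Mt l \<alpha> M) ** Mt_minus l \<alpha> M ** Omega ** Lsq"

definition G_plus :: "real \<Rightarrow> real \<Rightarrow> complex^(4 + 4)^4 \<Rightarrow> complex^4^4" where
  "G_plus l \<alpha> M = matrix_inv (Mt l \<alpha> M) ** Mt_plus l \<alpha> M ** Omega ** Lsq"

text \<open>For invertible \<open>Mt l \<alpha> M\<close> the two branches agree on the diagonal, since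
  \<open>G_plus + G_minus = Omega ** Lsq\<close> and the \<open>omega j\<close> (\<open>j = 1,\<dots>,4\<close>) sum to 0.\<close>

definition Green ::
  "real \<Rightarrow> real \<Rightarrow> real \<Rightarrow> complex^(4 + 4)^4 \<Rightarrow> real \<Rightarrow> real \<Rightarrow> complex" where
  "Green l \<alpha> k M x \<xi> =
     (if x \<le> \<xi> then of_real (\<alpha> / (4 * k)) * tdot (yvec \<alpha> x) (G_plus l \<alpha> M *v yvec \<alpha> \<xi>)
      else - of_real (\<alpha> / (4 * k)) * tdot (yvec \<alpha> x) (G_minus l \<alpha> M *v yvec \<alpha> \<xi>))"

text \<open>Representatives of elements of \<open>L\<^sup>2[-l,l]\<close>; equality of elements is equality almost
  everywhere with respect to \<open>lebesgue_on {-l..l}\<close>.\<close>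

definition L2_fun :: "real \<Rightarrow> (real \<Rightarrow> complex) set" where
  "L2_fun l = {w \<in> borel_measurable (lebesgue_on {-l..l}).
                 integrable (lebesgue_on {-l..l}) (\<lambda>x. (norm (w x))\<^sup>2)}"

definition K_op ::
  "real \<Rightarrow> real \<Rightarrow> real \<Rightarrow> complex^(4 + 4)^4 \<Rightarrow> (real \<Rightarrow> complex) \<Rightarrow> real \<Rightarrow> complex" where
  "K_op l \<alpha> k M w x = (LINT \<xi>|lebesgue_on {-l..l}. Green l \<alpha> k M x \<xi> * w \<xi>)"

definition Gmat :: "real \<Rightarrow> real \<Rightarrow> complex^(4 + 4)^4 \<Rightarrow> complex^4^4" where
  "Gmat l \<alpha> M =
     (G_plus l \<alpha> M - G_plus l \<alpha> (Qmat \<alpha>)) ** matrix_inv (Omega ** Lsq) ** Eps"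


section \<open>Objects depending on the spectral parameter\<close>

definition kappa :: "real \<Rightarrow> complex \<Rightarrow> complex" where
  "kappa k lam = (THE z. z ^ 4 = 1 - 1 / (lam * of_real k) \<and> 0 \<le> Arg z \<and> Arg z < pi / 2)"

definition yl :: "real \<Rightarrow> real \<Rightarrow> complex \<Rightarrow> 4 \<Rightarrow> real \<Rightarrow> complex" where
  "yl \<alpha> k lam j x =
     (if lam = 1 / of_real k then of_real x ^ (pos j - 1) / fact (pos j - 1)
      else exp (omega (int (pos j)) * kappa k lam * of_real \<alpha> * of_real x))"

definition ylvec :: "real \<Rightarrow> real \<Rightarrow> complex \<Rightarrow> real \<Rightarrow> complex^4" where
  "ylvec \<alpha> k lam x = (\<chi> j. yl \<alpha> k lam j x)"

definition Wl :: "real \<Rightarrow> real \<Rightarrow> complex \<Rightarrow> real \<Rightarrow> complex^4^4" where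
  "Wl \<alpha> k lam x = (\<chi> p q. nderiv UNIV (pos p - 1) (yl \<alpha> k lam q) x)"

definition Xl :: "real \<Rightarrow> real \<Rightarrow> complex \<Rightarrow> real \<Rightarrow> complex^4^4" where
  "Xl \<alpha> k lam x =
     diag (vector [0, 1, 1, 0]) ** matrix_inv (Wmat \<alpha> (-x)) ** Wl \<alpha> k lam (-x) +
     diag (vector [1, 0, 0, 1]) ** matrix_inv (Wmat \<alpha> x) ** Wl \<alpha> k lam x"

end

(*
  Variation of constants writes K_M[u](x) = y(x)^T v(x), where v(x) = a (S int(l) - int(x)), a = alpha/(4k),
  int(x) is the integral of Omega L^2 y u over [-l,x] and S = Mt^-1 Mt^+. Hence W(x) v(x) is the jet of
  h = K_M[u], which satisfies h^(4) + alpha^4 h = (alpha^4/k) u and the boundary conditions M B[h] = 0.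
  If h = lam u with lam nonzero, u is therefore a solution of u^(4) = (1/(lam k) - 1) alpha^4 u, that is, a
  combination of the y_lam; if h = 0, then v = 0, so every integral int(x) vanishes and u = 0 a.e.
  Conversely, for u = y_lam^T c and e = W^-1 W_lam c, the vectors lam e and v have the same derivative, so
  they agree as soon as they satisfy the same boundary condition. For e this condition reads
  e(-l) + S (e(l) - e(-l)) = 0, which is what the matrix in the theorem says. For M = Q one has
  S = diag(1,0,0,1), because the rows of Q^- annihilate y_1, y_4 and those of Q^+ annihilate y_2, y_3.
*)
theory Submission
  imports Defs
begin

section \<open>Wronskian matrices of exponentials\<close>

text \<open>The obstacle is that \<open>u\<close> is only integrable, so the components of int(x)
  need not be differentiable and W(x) v(x) cannot be differentiated factor by factor. What helps is
  that the sums of \<open>om q ^ n\<close> vanish for n = 1, 2, 3: in the first three derivatives of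
  h the kernel vanishes on the diagonal, and v can be treated as if it were constant. At order four
  the sum of \<open>om q ^ 4\<close> is -4; this yields the term (\<alpha>^4/k) u and absorbs the 4
  of \<alpha>/(4k). There a continuous representative of u is required. It exists in both directions
  of the equivalence, as h / lam or as y_lam^T c, while for h = 0 three derivatives already give W v
  = 0. The constant lam e - v disappears because the functional f(-l) + S (f(l) - f(-l)) sends a
  constant f to itself, whatever S is.\<close>

lemma pos_simps [simp]: "pos 1 = 1" "pos 2 = 2" "pos 3 = 3" "pos 4 = 4"
  by (simp_all add: pos_def)

lemma vector4_nth:
  "(vector [a, b, c, d] :: 'a::zero^4) $ 1 = a" "(vector [a, b, c, d] :: 'a^4) $ 2 = b"
  "(vector [a, b, c, d] :: 'a^4) $ 3 = c" "(vector [a, b, c, d] :: 'a^4) $ 4 = d"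
  by (simp_all add: vector_def)

abbreviation om :: "4 \<Rightarrow> complex" where
  "om q \<equiv> omega (int (pos q))"

lemma omega_conv_cis: "omega j = cis (pi / 4 * (2 * of_int j - 1))"
  by (simp add: omega_def cis_conv_exp)

lemma omega_add_one: "omega (j + 1) = \<i> * omega j"
proof -
  have "pi / 4 * (2 * of_int (j + 1) - 1) = pi / 2 + pi / 4 * (2 * of_int j - 1)"
    by (simp add: field_simps)
  then show ?thesis
    unfolding omega_conv_cis by (simp only: flip: cis_mult) simp
qed

lemma om_simps: "om 1 = omega 1" "om 2 = \<i> * omega 1" "om 3 = - omega 1" "om 4 = - \<i> * omega 1"
  using omega_add_one[of 1] omega_add_one[of 2] omega_add_one[of 3] by simp_all

lemma omega_1_sq: "omega 1 ^ 2 = \<i>"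
  by (simp add: omega_conv_cis Complex.DeMoivre)

lemma omega_neq_0 [simp]: "omega j \<noteq> 0"
  by (simp add: omega_conv_cis)

lemma om_power4: "om q ^ 4 = -1"
proof -
  have "omega 1 ^ 4 = (omega 1 ^ 2)^2" by simp
  then have "omega 1 ^ 4 = -1" unfolding omega_1_sq by simp
  then have "\<forall>q. om q ^ 4 = -1"
    unfolding forall_4 om_simps by (simp add: power_mult_distrib)
  then show ?thesis by blast
qed

text \<open>The parameter \<open>t\<close> stays free: \<open>t = \<alpha>\<close> gives
  \<open>Wmat\<close>, and \<open>t = kappa k lam * \<alpha>\<close> gives \<open>Wl\<close> when
  lam is not 1/k.\<close>

definition exp_wronskian :: "complex \<Rightarrow> real \<Rightarrow> complex^4^4" where
  "exp_wronskian t x = (\<chi> p q. (om q * t) ^ (pos p - 1) * exp (om q * t * of_real x))"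

text \<open>The inverse is a discrete Fourier transform, since the \<open>om q\<close> differ by fourth roots of unity.\<close>

definition exp_wronskian_inv :: "complex \<Rightarrow> real \<Rightarrow> complex^4^4" where
  "exp_wronskian_inv t x = (\<chi> q p. exp (- (om q * t * of_real x)) / (4 * (om q * t) ^ (pos p - 1)))"

lemma Wmat_eq_exp_wronskian: "Wmat \<alpha> x = exp_wronskian (of_real \<alpha>) x"
  by (simp add: Wmat_def exp_wronskian_def)

lemma exp_wronskian_inv_mult_exp_wronskian:
  assumes "t \<noteq> 0"
  shows "exp_wronskian_inv t x ** exp_wronskian t x = mat 1"
proof -
  have [simp]: "exp z * exp (- z) = 1" "exp (- z) * exp z = 1" for z :: complex
    by (simp_all flip: exp_add)
  have "(exp_wronskian_inv t x ** exp_wronskian t x) $ q $ r = mat 1 $ q $ r" for q r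
  proof -
    have "(exp_wronskian_inv t x ** exp_wronskian t x) $ q $ r =
        exp (- (om q * t * x)) * exp (om r * t * x) *
        (1 + om r / om q + (om r / om q)^2 + (om r / om q)^3) / 4"
      using assms
      by (simp add: matrix_matrix_mult_def exp_wronskian_def exp_wronskian_inv_def sum_4 field_simps)
    \<comment> \<open>The ratio \<open>om r / om q\<close> is a fourth root of unity, so this
      geometric sum is 4 if the ratio is 1 and 0 otherwise.\<close>
    moreover have "1 + om r / om q + (om r / om q)^2 + (om r / om q)^3 = (if q = r then 4 else 0)"
    proof -
      have "\<forall>q r. 1 + om r / om q + (om r / om q)^2 + (om r / om q)^3 = (if q = r then 4 else 0)"
        unfolding forall_4 om_simps by (simp add: power2_eq_square power3_eq_cube)
      then show ?thesis by blast
    qed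
    ultimately show ?thesis
      by (cases "q = r") (simp_all add: mat_def)
  qed
  then show ?thesis
    by (simp add: vec_eq_iff)
qed

lemma exp_wronskian_mult_exp_wronskian_inv: "t \<noteq> 0 \<Longrightarrow> exp_wronskian t x ** exp_wronskian_inv t x = mat 1"
  using exp_wronskian_inv_mult_exp_wronskian matrix_left_right_inverse by blast

lemma matrix_inv_unique:
  fixes A B :: "'a::field^'n^'n"
  assumes "A ** B = mat 1"
  shows "matrix_inv A = B"
proof -
  have BA: "B ** A = mat 1"
    using assms matrix_left_right_inverse by blast
  with assms have "A ** matrix_inv A = mat 1"
    unfolding matrix_inv_def by (metis (mono_tags, lifting) someI_ex)
  then have "B ** (A ** matrix_inv A) = B ** mat 1"
    by simp
  then show ?thesis
    by (simp add: matrix_mul_assoc BA)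
qed

lemma matrix_inv_Wmat: "\<alpha> > 0 \<Longrightarrow> matrix_inv (Wmat \<alpha> x) = exp_wronskian_inv (of_real \<alpha>) x"
  unfolding Wmat_eq_exp_wronskian by (intro matrix_inv_unique exp_wronskian_mult_exp_wronskian_inv) simp

section \<open>Functions with vanishing indefinite integral\<close>

text \<open>The positive and negative parts of \<open>f\<close> are densities of two finite measures
  that agree on every open ray. Rays determine a Borel measure that is finite on them, so the
  measures coincide, and then so do the densities almost everywhere.\<close>

lemma integral_rays_zero_imp_AE_zero:
  fixes f :: "real \<Rightarrow> real"
  assumes int: "integrable lborel f"
    and zero: "\<And>x. (LINT t|lborel. indicator {x<..} t * f t) = 0"
  shows "AE t in lborel. f t = 0"
proof -
  have meas [measurable]: "f \<in> borel_measurable borel"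
    using int by auto
  define P where "P = density lborel (\<lambda>t. ennreal (max 0 (f t)))"
  define N where "N = density lborel (\<lambda>t. ennreal (max 0 (- f t)))"
  have intp: "integrable lborel (\<lambda>t. indicator {x<..} t * max 0 (f t))"
    and intn: "integrable lborel (\<lambda>t. indicator {x<..} t * max 0 (- f t))" for x
    using int integrable_real_mult_indicator[of "{x<..}" lborel "\<lambda>t. max 0 (f t)"]
      integrable_real_mult_indicator[of "{x<..}" lborel "\<lambda>t. max 0 (- f t)"]
    by (auto intro!: integrable_max simp: mult.commute)
  have eP: "emeasure P {x<..} = ennreal (LINT t|lborel. indicator {x<..} t * max 0 (f t))" for x
    unfolding P_def
    by (subst emeasure_density, measurable, subst nn_integral_eq_integral[OF intp, symmetric])
      (auto intro!: nn_integral_cong split: split_indicator)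
  have eN: "emeasure N {x<..} = ennreal (LINT t|lborel. indicator {x<..} t * max 0 (- f t))" for x
    unfolding N_def
    by (subst emeasure_density, measurable, subst nn_integral_eq_integral[OF intn, symmetric])
      (auto intro!: nn_integral_cong split: split_indicator)
  have "(LINT t|lborel. indicator {x<..} t * max 0 (f t)) -
      (LINT t|lborel. indicator {x<..} t * max 0 (- f t)) = 0" for x
  proof -
    have "(LINT t|lborel. indicator {x<..} t * max 0 (f t)) -
      (LINT t|lborel. indicator {x<..} t * max 0 (- f t)) =
      (LINT t|lborel. indicator {x<..} t * max 0 (f t) - indicator {x<..} t * max 0 (- f t))"
      by (rule Bochner_Integration.integral_diff[OF intp intn, symmetric])
    also have "\<dots> = (LINT t|lborel. indicator {x<..} t * f t)"
      by (intro Bochner_Integration.integral_cong) (auto split: split_indicator)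
    finally show ?thesis
      using zero by simp
  qed
  then have "emeasure P {x<..} = emeasure N {x<..}" for x
    unfolding eP eN by simp
  then have "P = N"
    by (intro measure_eqI_lessThan) (simp_all add: eP eN, simp_all add: P_def N_def)
  \<comment> \<open>Finiteness of the total mass is what allows equal measures to be turned into
    densities equal almost everywhere.\<close>
  moreover have "integral\<^sup>N lborel (\<lambda>t. ennreal (max 0 (f t))) \<noteq> \<infinity>"
    using integrable_max[OF integrable_zero int]
    by (subst nn_integral_eq_integral) auto
  ultimately have "AE t in lborel. ennreal (max 0 (f t)) = ennreal (max 0 (- f t))"
    unfolding P_def N_def by (subst (asm) finite_density_unique) auto
  then show ?thesis
    by eventually_elim (auto simp: max_def split: if_splits)
qed

lemma integrals_zero_imp_AE_zero_real:
  fixes f :: "real \<Rightarrow> real"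
  assumes int: "f absolutely_integrable_on {a..b}"
    and zero: "\<And>x. x \<in> {a..b} \<Longrightarrow> integral {a..x} f = 0"
  shows "AE x in lebesgue_on {a..b}. f x = 0"
proof -
  define g where "g x = indicator {a..b} x * f x" for x
  have g: "integrable lebesgue g"
    using int unfolding g_def set_integrable_def by simp
  \<comment> \<open>The argument with rays compares Borel measures, so the Lebesgue measurable
    \<open>g\<close> is exchanged for a Borel version.\<close>
  then obtain h where h: "h \<in> borel_measurable lborel" "AE x in lborel. g x = h x"
    using completion_ex_borel_measurable_real[of g lborel] by auto
  have gh: "AE x in lebesgue. g x = h x"
    using h(2) by (rule AE_completion)
  have h': "h \<in> borel_measurable lebesgue"
    using h(1) by (rule measurable_completion)
  have "integrable lebesgue h"
    using g gh h' by (subst integrable_cong_AE[of _ _ g]) auto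
  then have ih: "integrable lborel h"
    using h(1) integrable_completion by blast
  have "AE t in lborel. h t = 0"
  proof (rule integral_rays_zero_imp_AE_zero[OF ih])
    fix x
    have "(LINT t|lborel. indicator {x<..} t * h t) = (LINT t|lebesgue. indicator {x<..} t * h t)"
      using h(1) by (intro integral_completion[symmetric]) auto
    also have "\<dots> = (LINT t|lebesgue. indicator {x<..} t * g t)"
      using gh g h' by (intro integral_cong_AE borel_measurable_times borel_measurable_indicator) auto
    also have "\<dots> = (LINT t:{a..b} \<inter> {x<..}|lebesgue. f t)"
      unfolding set_lebesgue_integral_def
      by (intro Bochner_Integration.integral_cong) (auto simp: g_def split: split_indicator)
    also have "\<dots> = integral ({a..b} \<inter> {x<..}) f"
      using int by (intro set_lebesgue_integral_eq_integral set_integrable_subset[OF int]) auto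
    also have "\<dots> = 0"
    proof -
      \<comment> \<open>The ray contains the interval, misses it, or cuts it at \<open>x\<close>; in
        the last case the integral is a difference of two vanishing ones.\<close>
      consider "x < a" | "x > b" | "x \<in> {a..b}" by fastforce
      then show ?thesis
      proof cases
        case 1
        then have "{a..b} \<inter> {x<..} = {a..b}" by auto
        then show ?thesis using zero[of b] by (cases "a \<le> b") auto
      next
        case 2
        then have "{a..b} \<inter> {x<..} = {}" by auto
        then show ?thesis by simp
      next
        case 3
        then have "{a..b} \<inter> {x<..} = {x<..b}" by auto
        moreover have "integral {x<..b} f = integral {x..b} f"
          by (rule integral_spike_set; rule negligible_subset[of "{x}"]) auto
        moreover have "integral {a..x} f + integral {x..b} f = integral {a..b} f"
          using 3 int by (intro Henstock_Kurzweil_Integration.integral_combine)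
            (auto simp: absolutely_integrable_on_def)
        ultimately show ?thesis
          using zero[of b] zero[OF 3] 3 by simp
      qed
    qed
    finally show "(LINT t|lborel. indicator {x<..} t * h t) = 0" .
  qed
  then have "AE t in lebesgue. h t = 0"
    by (rule AE_completion)
  with gh have "AE t in lebesgue. g t = 0"
    by eventually_elim simp
  then show ?thesis
    by (subst AE_restrict_space_iff) (auto simp: g_def)
qed

lemma integrals_zero_imp_AE_zero:
  fixes f :: "real \<Rightarrow> complex"
  assumes int: "f absolutely_integrable_on {a..b}"
    and zero: "\<And>x. x \<in> {a..b} \<Longrightarrow> integral {a..x} f = 0"
  shows "AE x in lebesgue_on {a..b}. f x = 0"
proof -
  have sub: "f integrable_on {a..x}" if "x \<in> {a..b}" for x
    using that int by (rule_tac integrable_subinterval_real[of f a b]) (auto simp: absolutely_integrable_on_def)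
  have "AE x in lebesgue_on {a..b}. (Re \<circ> f) x = 0"
  proof (rule integrals_zero_imp_AE_zero_real)
    show "integral {a..x} (Re \<circ> f) = 0" if "x \<in> {a..b}" for x
      using integral_linear[OF sub[OF that] bounded_linear_Re] zero[OF that] by simp
  qed (rule absolutely_integrable_linear[OF int bounded_linear_Re])
  moreover have "AE x in lebesgue_on {a..b}. (Im \<circ> f) x = 0"
  proof (rule integrals_zero_imp_AE_zero_real)
    show "integral {a..x} (Im \<circ> f) = 0" if "x \<in> {a..b}" for x
      using integral_linear[OF sub[OF that] bounded_linear_Im] zero[OF that] by simp
  qed (rule absolutely_integrable_linear[OF int bounded_linear_Im])
  ultimately show ?thesis
    by eventually_elim (simp add: complex_eq_iff)
qed

section \<open>Jets of solutions of fourth-order equations\<close>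

lemma has_vector_derivative_exp_mult:
  "((\<lambda>x. exp (a * complex_of_real x)) has_vector_derivative a * exp (a * of_real x)) (at x within S)"
  by (rule has_vector_derivative_real_field) (auto intro!: derivative_eq_intros)

text \<open>\<open>F\<close> plays the role of the fourth derivative. The index \<open>4\<close> is treated separately because
  \<open>4 + 1 = 1\<close> in the numeral type.\<close>

definition jet :: "real set \<Rightarrow> (real \<Rightarrow> complex^4) \<Rightarrow> (real \<Rightarrow> complex) \<Rightarrow> bool" where
  "jet S D F \<longleftrightarrow> (\<forall>x\<in>S. \<forall>p. ((\<lambda>x. D x $ p) has_vector_derivative
     (if p = 4 then F x else D x $ (p + 1))) (at x within S))"

lemma jetD:
  assumes "jet S D F" "x \<in> S"
  shows "((\<lambda>x. D x $ 1) has_vector_derivative D x $ 2) (at x within S)"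
    "((\<lambda>x. D x $ 2) has_vector_derivative D x $ 3) (at x within S)"
    "((\<lambda>x. D x $ 3) has_vector_derivative D x $ 4) (at x within S)"
    "((\<lambda>x. D x $ 4) has_vector_derivative F x) (at x within S)"
proof -
  have "\<forall>p. ((\<lambda>x. D x $ p) has_vector_derivative
     (if p = 4 then F x else D x $ (p + 1))) (at x within S)"
    using assms by (simp add: jet_def)
  then show "((\<lambda>x. D x $ 1) has_vector_derivative D x $ 2) (at x within S)"
    "((\<lambda>x. D x $ 2) has_vector_derivative D x $ 3) (at x within S)"
    "((\<lambda>x. D x $ 3) has_vector_derivative D x $ 4) (at x within S)"
    "((\<lambda>x. D x $ 4) has_vector_derivative F x) (at x within S)"
    unfolding forall_4 by simp_all
qed

lemma jetI:
  assumes "\<And>x. x \<in> S \<Longrightarrow> ((\<lambda>x. D x $ 1) has_vector_derivative D x $ 2) (at x within S)"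
    "\<And>x. x \<in> S \<Longrightarrow> ((\<lambda>x. D x $ 2) has_vector_derivative D x $ 3) (at x within S)"
    "\<And>x. x \<in> S \<Longrightarrow> ((\<lambda>x. D x $ 3) has_vector_derivative D x $ 4) (at x within S)"
    "\<And>x. x \<in> S \<Longrightarrow> ((\<lambda>x. D x $ 4) has_vector_derivative F x) (at x within S)"
  shows "jet S D F"
  unfolding jet_def forall_4 using assms by simp

text \<open>Variation of constants for y'''' + t^4 y = 0: in the derivative of W^-1 D all terms
  cancel except the last column of W^-1 times the residual of the equation. With residual 0 it shows
  that the coefficients are constant; with a nonzero residual it gives the derivative of e = W^-1
  W_lam c.\<close>

lemma has_vector_derivative_exp_wronskian_inv_jet:
  assumes "jet S D F" "x \<in> S" "t \<noteq> 0"
  shows "((\<lambda>x. (exp_wronskian_inv t x *v D x) $ q) has_vector_derivative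
     exp (- (om q * t * of_real x)) / (4 * (om q * t) ^ 3) * (F x + t ^ 4 * D x $ 1)) (at x within S)"
proof -
  define \<mu> where "\<mu> = om q * t"
  have \<mu>: "\<mu> \<noteq> 0" "\<mu> ^ 4 = - (t ^ 4)"
    using assms om_power4[of q] by (simp_all add: \<mu>_def power_mult_distrib)
  have d: "((\<lambda>x. exp (- \<mu> * of_real x) * ((D x $ 1 + D x $ 2 * (1/\<mu>) + D x $ 3 * (1/\<mu>^2) + D x $ 4 * (1/\<mu>^3)) * (1/4)))
      has_vector_derivative
      exp (- \<mu> * of_real x) * ((D x $ 2 + D x $ 3 * (1/\<mu>) + D x $ 4 * (1/\<mu>^2) + F x * (1/\<mu>^3)) * (1/4)) +
      (- \<mu> * exp (- \<mu> * of_real x)) * ((D x $ 1 + D x $ 2 * (1/\<mu>) + D x $ 3 * (1/\<mu>^2) + D x $ 4 * (1/\<mu>^3)) * (1/4)))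
      (at x within S)"
    by (intro has_vector_derivative_mult has_vector_derivative_exp_mult has_vector_derivative_add
        has_vector_derivative_mult_left jetD[OF assms(1,2)])
  have e: "exp (- \<mu> * of_real x) * ((D x $ 2 + D x $ 3 * (1/\<mu>) + D x $ 4 * (1/\<mu>^2) + F x * (1/\<mu>^3)) * (1/4)) +
      (- \<mu> * exp (- \<mu> * of_real x)) * ((D x $ 1 + D x $ 2 * (1/\<mu>) + D x $ 3 * (1/\<mu>^2) + D x $ 4 * (1/\<mu>^3)) * (1/4))
      = exp (- \<mu> * of_real x) / (4 * \<mu> ^ 3) * (F x - \<mu> ^ 4 * D x $ 1)"
    using \<mu>(1) by (simp add: field_simps power2_eq_square power3_eq_cube power4_eq_xxxx)
  have f: "(\<lambda>x. (exp_wronskian_inv t x *v D x) $ q) = (\<lambda>x.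
    exp (- \<mu> * of_real x) * ((D x $ 1 + D x $ 2 * (1/\<mu>) + D x $ 3 * (1/\<mu>^2) + D x $ 4 * (1/\<mu>^3)) * (1/4)))"
    by (rule ext) (simp add: exp_wronskian_inv_def matrix_vector_mult_def sum_4 \<mu>_def field_simps)
  have "exp (- \<mu> * of_real x) / (4 * \<mu> ^ 3) * (F x - \<mu> ^ 4 * D x $ 1) =
      exp (- (om q * t * of_real x)) / (4 * (om q * t) ^ 3) * (F x + t ^ 4 * D x $ 1)"
    unfolding \<mu>(2) by (simp add: \<mu>_def)
  with d show ?thesis
    unfolding e f by (simp only:)
qed

lemma jet_exp_wronskian: "jet S (\<lambda>x. exp_wronskian t x *v c) (\<lambda>x. - (t ^ 4) * (exp_wronskian t x *v c) $ 1)"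
proof (rule jetI)
  fix x assume "x \<in> S"
  have *: "((\<lambda>x. (exp_wronskian t x *v c) $ p) has_vector_derivative
    (\<Sum>q\<in>UNIV. (om q * t) ^ (pos p - 1) * ((om q * t) * exp (om q * t * of_real x)) * c $ q))
    (at x within S)" for p
    unfolding exp_wronskian_def matrix_vector_mult_def vec_lambda_beta
    by (intro has_vector_derivative_sum has_vector_derivative_mult_left
        has_vector_derivative_mult_right has_vector_derivative_exp_mult)
  \<comment> \<open>The right-nested product is the form to which \<open>mult.assoc\<close> brings
    the fourth power.\<close>
  have om4: "om q * (t * (om q * (t * (om q * (t * (om q * (t * z))))))) = - (t ^ 4 * z)" for q z
  proof -
    have "om q * (t * (om q * (t * (om q * (t * (om q * (t * z))))))) = om q ^ 4 * t ^ 4 * z"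
      by (simp add: power_numeral_reduce)
    then show ?thesis by (simp add: om_power4)
  qed
  show "((\<lambda>x. (exp_wronskian t x *v c) $ 1) has_vector_derivative (exp_wronskian t x *v c) $ 2) (at x within S)"
    "((\<lambda>x. (exp_wronskian t x *v c) $ 2) has_vector_derivative (exp_wronskian t x *v c) $ 3) (at x within S)"
    "((\<lambda>x. (exp_wronskian t x *v c) $ 3) has_vector_derivative (exp_wronskian t x *v c) $ 4) (at x within S)"
    "((\<lambda>x. (exp_wronskian t x *v c) $ 4) has_vector_derivative - (t ^ 4) * (exp_wronskian t x *v c) $ 1) (at x within S)"
    using *[of 1] *[of 2] *[of 3] *[of 4]
    by (simp_all add: exp_wronskian_def matrix_vector_mult_def sum_distrib_left om4 power2_eq_square power3_eq_cube
      mult.assoc)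
qed

lemma zero_derivative_imp_constant:
  fixes f :: "real \<Rightarrow> complex"
  assumes "\<And>x. x \<in> {a..b} \<Longrightarrow> (f has_vector_derivative 0) (at x within {a..b})"
  shows "\<exists>c. \<forall>x\<in>{a..b}. f x = c"
  using has_vector_derivative_zero_constant[of "{a..b}" f] assms by (metis convex_real_interval(5))

lemma jet_exp_eq_exp_wronskian:
  assumes "jet {a..b} D (\<lambda>x. - (t ^ 4) * D x $ 1)" "t \<noteq> 0"
  shows "\<exists>c. \<forall>x\<in>{a..b}. D x = exp_wronskian t x *v c"
proof -
  have "((\<lambda>x. (exp_wronskian_inv t x *v D x) $ q) has_vector_derivative 0) (at x within {a..b})"
      if "x \<in> {a..b}" for x q
    using has_vector_derivative_exp_wronskian_inv_jet[OF assms(1) that assms(2), of q] by simp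
  then have "\<exists>c. \<forall>x\<in>{a..b}. (exp_wronskian_inv t x *v D x) $ q = c" for q
    by (intro zero_derivative_imp_constant)
  then obtain c where c: "\<And>q x. x \<in> {a..b} \<Longrightarrow> (exp_wronskian_inv t x *v D x) $ q = c q"
    by metis
  have "D x = exp_wronskian t x *v (\<chi> q. c q)" if "x \<in> {a..b}" for x
  proof -
    have "(\<chi> q. c q) = exp_wronskian_inv t x *v D x"
      by (simp add: vec_eq_iff c[OF that])
    then show ?thesis
      by (simp add: matrix_vector_mul_assoc exp_wronskian_mult_exp_wronskian_inv assms(2))
  qed
  then show ?thesis by blast
qed

section \<open>The degenerate case y'''' = 0\<close>

text \<open>This is the matrix exponential of x times the nilpotent shift, which is why its inverse
  is its value at \<open>-x\<close>.\<close>

definition poly_wronskian :: "real \<Rightarrow> complex^4^4" where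
  "poly_wronskian x = (\<chi> p q. if pos p \<le> pos q then of_real x ^ (pos q - pos p) / fact (pos q - pos p) else 0)"

lemma poly_wronskian_mult_neg: "poly_wronskian x ** poly_wronskian (- x) = mat 1"
  unfolding vec_eq_iff forall_4
  by (simp add: poly_wronskian_def matrix_matrix_mult_def sum_4 mat_def fact_numeral field_simps power2_eq_square power3_eq_cube)

text \<open>For \<open>n = 0\<close> the truncated exponent \<open>n - 1\<close> is harmless,
  because the factor \<open>of_nat n\<close> is 0.\<close>

lemma has_vector_derivative_power_of_real:
  "((\<lambda>x. complex_of_real x ^ n) has_vector_derivative of_nat n * of_real x ^ (n - 1)) (at x within S)"
  by (rule has_vector_derivative_real_field) (auto intro!: derivative_eq_intros)

lemma jet_poly_wronskian: "jet S (\<lambda>x. poly_wronskian x *v c) (\<lambda>x. 0)"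
proof (rule jetI)
  fix x assume "x \<in> S"
  have deriv_if: "((\<lambda>x. if P then complex_of_real x ^ n / a else 0) has_vector_derivative
      (if P then of_nat n * of_real x ^ (n - 1) / a else 0)) (at x within S)" for P n a
    using has_vector_derivative_divide[OF has_vector_derivative_power_of_real] by (cases P) auto
  have *: "((\<lambda>x. (poly_wronskian x *v c) $ p) has_vector_derivative
    (\<Sum>q\<in>UNIV. (if pos p \<le> pos q then of_nat (pos q - pos p) * of_real x ^ (pos q - pos p - 1) / fact (pos q - pos p) else 0) * c $ q))
    (at x within S)" for p
    unfolding poly_wronskian_def matrix_vector_mult_def
    unfolding vec_lambda_beta
    by (intro has_vector_derivative_sum has_vector_derivative_mult_left deriv_if)
  show "((\<lambda>x. (poly_wronskian x *v c) $ 1) has_vector_derivative (poly_wronskian x *v c) $ 2) (at x within S)"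
    "((\<lambda>x. (poly_wronskian x *v c) $ 2) has_vector_derivative (poly_wronskian x *v c) $ 3) (at x within S)"
    "((\<lambda>x. (poly_wronskian x *v c) $ 3) has_vector_derivative (poly_wronskian x *v c) $ 4) (at x within S)"
    "((\<lambda>x. (poly_wronskian x *v c) $ 4) has_vector_derivative 0) (at x within S)"
    using *[of 1] *[of 2] *[of 3] *[of 4]
    by (simp_all add: poly_wronskian_def matrix_vector_mult_def sum_4 fact_numeral)
qed

text \<open>With N the nilpotent shift, the hypothesis says D' = N D, so exp(-x N) D is
  constant.\<close>

lemma jet_zero_eq_poly_wronskian:
  assumes "jet {a..b} D (\<lambda>x. 0)"
  shows "\<exists>c. \<forall>x\<in>{a..b}. D x = poly_wronskian x *v c"
proof -
  have *: "((\<lambda>x. D x $ p * (of_real x ^ n * b')) has_vector_derivative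
      D x $ p * (of_nat n * of_real x ^ (n - 1) * b') +
      (if p = 4 then 0 else D x $ (p + 1)) * (of_real x ^ n * b')) (at x within {a..b})"
    if "x \<in> {a..b}" "jet {a..b} D (\<lambda>x. 0)" for p n x b'
    using that unfolding jet_def
    by (intro has_vector_derivative_mult has_vector_derivative_mult_left
        has_vector_derivative_power_of_real) simp
  \<comment> \<open>Sign, factorial and case distinction are gathered in one constant factor, so
    that every summand has the shape differentiated in \<open>*\<close>.\<close>
  have eq: "(\<lambda>x. (poly_wronskian (-x) *v D x) $ q) =
    (\<lambda>x. \<Sum>p\<in>UNIV. D x $ p * (of_real x ^ (pos p - pos q) * (if pos q \<le> pos p then (-1) ^ (pos p - pos q) / fact (pos p - pos q) else 0)))" for q
    by (rule ext) (auto simp: poly_wronskian_def matrix_vector_mult_def power_minus[of "of_real _"] intro!: sum.cong)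
  have "\<forall>q. ((\<lambda>x. (poly_wronskian (-x) *v D x) $ q) has_vector_derivative 0) (at x within {a..b})"
    if "x \<in> {a..b}" for x
    unfolding eq forall_4
    by (intro conjI; rule has_vector_derivative_eq_rhs;
        (rule has_vector_derivative_sum, rule *[OF that assms])?;
        simp add: sum_4 fact_numeral power2_eq_square power3_eq_cube field_simps)
  then have "\<exists>c. \<forall>x\<in>{a..b}. (poly_wronskian (-x) *v D x) $ q = c" for q
    by (intro zero_derivative_imp_constant) auto
  then obtain c where c: "\<And>q x. x \<in> {a..b} \<Longrightarrow> (poly_wronskian (-x) *v D x) $ q = c q"
    by metis
  have "D x = poly_wronskian x *v (\<chi> q. c q)" if "x \<in> {a..b}" for x
  proof -
    have "(\<chi> q. c q) = poly_wronskian (-x) *v D x"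
      by (simp add: vec_eq_iff c[OF that])
    then show ?thesis
      by (simp add: matrix_vector_mul_assoc poly_wronskian_mult_neg)
  qed
  then show ?thesis by blast
qed

section \<open>The basis functions for the spectral parameter\<close>

text \<open>Identifies all iterated derivatives at once from a chain of candidates;
  \<open>nontriv\<close> rules out isolated points, where \<open>vector_derivative\<close> is not
  determined.\<close>

lemma nderiv_eqI:
  assumes deriv: "\<And>n x. x \<in> S \<Longrightarrow> (g n has_vector_derivative g (Suc n) x) (at x within S)"
    and nontriv: "\<And>x. x \<in> S \<Longrightarrow> at x within S \<noteq> bot"
    and f: "\<And>x. x \<in> S \<Longrightarrow> f x = g 0 x"
    and x: "x \<in> S"
  shows "nderiv S n f x = g n x"
  using x
proof (induction n arbitrary: x)
  case 0
  then show ?case by (simp add: f)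
next
  case (Suc n)
  have "(nderiv S n f has_vector_derivative g (Suc n) x) (at x within S)"
    by (rule has_vector_derivative_transform[OF Suc.prems Suc.IH deriv[OF Suc.prems]])
  then show ?case
    using nontriv[OF Suc.prems] by (simp add: vector_derivative_within)
qed

lemma nderiv_exp:
  "nderiv UNIV n (\<lambda>x. exp (a * of_real x)) x = a ^ n * exp (a * of_real x)"
proof (rule nderiv_eqI[where g = "\<lambda>n x. a ^ n * exp (a * of_real x)"])
  show "((\<lambda>x. a ^ n * exp (a * of_real x)) has_vector_derivative a ^ Suc n * exp (a * of_real x)) (at x)"
    for n x
    using has_vector_derivative_mult_right[OF has_vector_derivative_exp_mult[of a x UNIV], of "a ^ n"]
    by (simp add: mult_ac)
qed auto

lemma nderiv_power:
  "nderiv UNIV n (\<lambda>x. of_real x ^ m / fact m) x =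
    (if n \<le> m then of_real x ^ (m - n) / fact (m - n) else 0)"
proof (rule nderiv_eqI[where g = "\<lambda>n x. if n \<le> m then of_real x ^ (m - n) / fact (m - n) else 0"])
  fix n :: nat and x :: real
  have "((\<lambda>x. of_real x ^ (m - n) / fact (m - n)) has_vector_derivative
      of_nat (m - n) * of_real x ^ (m - n - 1) / (fact (m - n) :: complex)) (at x)"
    by (intro has_vector_derivative_divide has_vector_derivative_power_of_real)
  moreover have "of_nat (m - n) * of_real x ^ (m - n - 1) / (fact (m - n) :: complex) =
      of_real x ^ (m - Suc n) / fact (m - Suc n)" if "n < m"
    using that fact_reduce[of "m - n", where ?'a = complex] by simp
  ultimately show "((\<lambda>x. if n \<le> m then of_real x ^ (m - n) / fact (m - n) else 0) has_vector_derivative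
      (if Suc n \<le> m then of_real x ^ (m - Suc n) / fact (m - Suc n) else (0::complex))) (at x)"
    by (cases "n < m"; cases "n = m") auto
qed auto

lemma Wl_eq_poly_wronskian: "lam = 1 / of_real k \<Longrightarrow> Wl \<alpha> k lam x = poly_wronskian x"
  unfolding vec_eq_iff forall_4
  by (simp add: Wl_def yl_def[abs_def] nderiv_power poly_wronskian_def)

lemma Wl_eq_exp_wronskian: "lam \<noteq> 1 / of_real k \<Longrightarrow> Wl \<alpha> k lam x = exp_wronskian (kappa k lam * of_real \<alpha>) x"
  using nderiv_exp[of _ "om _ * kappa k lam * of_real \<alpha>"]
  by (simp add: vec_eq_iff Wl_def yl_def[abs_def] exp_wronskian_def mult.assoc)

lemma tdot_ylvec: "tdot (ylvec \<alpha> k lam x) c = (Wl \<alpha> k lam x *v c) $ 1"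
  by (simp add: tdot_def ylvec_def Wl_def matrix_vector_mult_def)

lemma tdot_yvec: "tdot (yvec \<alpha> x) c = (Wmat \<alpha> x *v c) $ 1"
  by (simp add: tdot_def yvec_def Wmat_def matrix_vector_mult_def)

section \<open>The root kappa and the solution space for lam\<close>

text \<open>Zero belongs to the sector because \<open>Arg 0 = 0\<close>.\<close>

lemma Arg_first_quadrant_iff:
  "0 \<le> Arg z \<and> Arg z < pi / 2 \<longleftrightarrow> z = 0 \<or> 0 < Re z \<and> 0 \<le> Im z"
  using Arg_Re_pos[of z] Arg_less_0[of z] by (auto simp: abs_if)

text \<open>Fourth roots of the same number differ by a power of \<i>. The four rotations of the
  half-open sector cover the plane, which gives existence, and overlap only at 0, which gives
  uniqueness. This makes the description in \<open>kappa\<close> meaningful.\<close>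

lemma ex1_fourth_root_first_quadrant: "\<exists>!z. z ^ 4 = w \<and> 0 \<le> Arg z \<and> Arg z < pi / 2"
proof (rule ex_ex1I)
  define z where "z = csqrt (csqrt w)"
  have z4: "z ^ 4 = w"
  proof -
    have "z ^ 4 = (z\<^sup>2)\<^sup>2" by simp
    then show ?thesis by (simp add: z_def)
  qed
  have roots: "(- z) ^ 4 = w" "(\<i> * z) ^ 4 = w" "(- \<i> * z) ^ 4 = w"
    using z4 by (simp_all add: power_mult_distrib)
  have "(z = 0 \<or> 0 < Re z \<and> 0 \<le> Im z) \<or> (0 < Re (- z) \<and> 0 \<le> Im (- z)) \<or>
    (0 < Re (\<i> * z) \<and> 0 \<le> Im (\<i> * z)) \<or> (0 < Re (- \<i> * z) \<and> 0 \<le> Im (- \<i> * z))"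
    by (auto simp: complex_eq_iff)
  then show "\<exists>z. z ^ 4 = w \<and> 0 \<le> Arg z \<and> Arg z < pi / 2"
    unfolding Arg_first_quadrant_iff using z4 roots by blast
next
  fix z y assume z: "z ^ 4 = w \<and> 0 \<le> Arg z \<and> Arg z < pi / 2" and y: "y ^ 4 = w \<and> 0 \<le> Arg y \<and> Arg y < pi / 2"
  have "(z - y) * (z + y) * (z - \<i> * y) * (z + \<i> * y) = z ^ 4 - y ^ 4"
    by (simp add: algebra_simps power4_eq_xxxx)
  also have "\<dots> = 0"
    using z y by simp
  finally have "z = y \<or> z = - y \<or> z = \<i> * y \<or> z = - (\<i> * y)"
    by (simp add: eq_neg_iff_add_eq_0 disj_assoc)
  then show "z = y"
    using z y unfolding Arg_first_quadrant_iff by (elim disjE) auto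
qed

lemma kappa_power4: "kappa k lam ^ 4 = 1 - 1 / (lam * of_real k)"
  using theI'[OF ex1_fourth_root_first_quadrant[of "1 - 1 / (lam * of_real k)"]]
  unfolding kappa_def by blast

lemma kappa_neq_0:
  assumes "lam \<noteq> 1 / of_real k" "k \<noteq> 0" "lam \<noteq> 0"
  shows "kappa k lam \<noteq> 0"
  using kappa_power4[of k lam] assms by (auto simp: field_simps)

text \<open>One equation serves both cases of \<open>Wl\<close>: its coefficient is -(kappa
  \<alpha>)^4 and becomes 0 exactly at lam = 1/k.\<close>

lemma jet_Wl:
  assumes "lam \<noteq> 0" "k \<noteq> 0"
  shows "jet S (\<lambda>x. Wl \<alpha> k lam x *v c)
    (\<lambda>x. (1 / (lam * of_real k) - 1) * of_real \<alpha> ^ 4 * (Wl \<alpha> k lam x *v c) $ 1)"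
proof (cases "lam = 1 / of_real k")
  case True
  then show ?thesis
    using assms jet_poly_wronskian[of S c] by (simp add: Wl_eq_poly_wronskian)
next
  case False
  have "- ((kappa k lam * of_real \<alpha>) ^ 4) = (1 / (lam * of_real k) - 1) * of_real \<alpha> ^ 4"
    by (simp add: power_mult_distrib kappa_power4 left_diff_distrib)
  then show ?thesis
    using jet_exp_wronskian[of S "kappa k lam * of_real \<alpha>" c] False by (simp add: Wl_eq_exp_wronskian)
qed

lemma jet_eq_Wl:
  assumes "lam \<noteq> 0" "k \<noteq> 0" "\<alpha> \<noteq> 0"
    and jet: "jet {a..b} D (\<lambda>x. (1 / (lam * of_real k) - 1) * of_real \<alpha> ^ 4 * D x $ 1)"
  shows "\<exists>c. \<forall>x\<in>{a..b}. D x = Wl \<alpha> k lam x *v c"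
proof (cases "lam = 1 / of_real k")
  case True
  then show ?thesis
    using assms jet_zero_eq_poly_wronskian[of a b D] by (simp add: Wl_eq_poly_wronskian)
next
  case False
  have "(1 / (lam * of_real k) - 1) * of_real \<alpha> ^ 4 = - ((kappa k lam * of_real \<alpha>) ^ 4)"
    by (simp add: power_mult_distrib kappa_power4 left_diff_distrib)
  then show ?thesis
    using jet jet_exp_eq_exp_wronskian[of a b D "kappa k lam * of_real \<alpha>"] False assms kappa_neq_0
    by (simp add: Wl_eq_exp_wronskian)
qed

text \<open>A kernel vector \<open>c\<close> makes y^T c a solution with boundary values M B = Mt c
  = 0. Well-posedness annihilates this function, hence its jet at 0, and \<open>Wmat\<close> is
  injective there.\<close>

lemma well_posed_imp_invertible_Mt:
  assumes "l > 0" "\<alpha> > 0" "well_posed l \<alpha> M"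
  shows "invertible (Mt l \<alpha> M)"
proof -
  have "c = 0" if c: "Mt l \<alpha> M *v c = 0" for c
  proof -
    define t where "t = complex_of_real \<alpha>"
    \<comment> \<open>\<open>g n\<close> is the explicit n-th derivative of y^T c, so the jet of
      \<open>g 0\<close> is \<open>Wmat\<close> applied to \<open>c\<close>.\<close>
    define g where "g n x = (\<Sum>q\<in>UNIV. (om q * t) ^ n * exp (om q * t * of_real x) * c $ q)" for n x
    have deriv: "(g n has_vector_derivative g (Suc n) x) (at x within S)" for n x S
    proof -
      have "((\<lambda>x. \<Sum>q\<in>UNIV. (om q * t) ^ n * exp (om q * t * of_real x) * c $ q) has_vector_derivative
          (\<Sum>q\<in>UNIV. (om q * t) ^ n * (om q * t * exp (om q * t * of_real x)) * c $ q)) (at x within S)"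
        by (intro has_vector_derivative_sum has_vector_derivative_mult_left
            has_vector_derivative_mult_right has_vector_derivative_exp_mult)
      then show ?thesis
        by (simp add: g_def[abs_def] mult_ac)
    qed
    have nd: "nderiv {-l..l} n (g 0) x = g n x" if "x \<in> {-l..l}" for n x
      by (rule nderiv_eqI[where g = g and S = "{-l..l}", OF deriv _ _ that]) (use assms(1) in \<open>auto simp: trivial_limit_within\<close>)
    have W: "Wmat \<alpha> x *v c = (\<chi> p. g (pos p - 1) x)" for x
      by (simp add: vec_eq_iff Wmat_def g_def matrix_vector_mult_def t_def)
    have "C_on 4 {-l..l} (g 0)"
      unfolding C_on_def
    proof (intro conjI allI impI ballI)
      fix p x assume "x \<in> {-l..l}"
      have "(nderiv {-l..l} p (g 0) has_vector_derivative g (Suc p) x) (at x within {-l..l})"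
        by (rule has_vector_derivative_transform[OF \<open>x \<in> _\<close> nd deriv])
      then show "nderiv {-l..l} p (g 0) differentiable at x within {-l..l}"
        by (rule differentiableI_vector)
    next
      have "continuous_on {-l..l} (g 4)"
        using deriv by (rule continuous_on_vector_derivative)
      then show "continuous_on {-l..l} (nderiv {-l..l} 4 (g 0))"
        by (subst continuous_on_cong[OF refl nd])
    qed
    moreover have "nderiv {-l..l} 4 (g 0) x + of_real (\<alpha> ^ 4) * g 0 x = 0" if "x \<in> {-l..l}" for x
      unfolding nd[OF that]
      by (simp add: g_def t_def power_mult_distrib om_power4 sum_distrib_left sum_negf mult.assoc)
    moreover have "M *v bvals l (g 0) = 0"
    proof -
      have "(M *v bvals l (g 0)) $ i = (left_block M *v (Wmat \<alpha> (-l) *v c)) $ i +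
          (right_block M *v (Wmat \<alpha> l *v c)) $ i" for i
        using assms(1) unfolding W
        by (simp add: matrix_vector_mult_def bvals_def left_block_def right_block_def nd
            UNIV_Plus_UNIV[symmetric] sum.Plus del: UNIV_Plus_UNIV)
      then have "M *v bvals l (g 0) = Mt l \<alpha> M *v c"
        by (simp add: vec_eq_iff Mt_def Mt_minus_def Mt_plus_def matrix_vector_mult_add_rdistrib
            matrix_vector_mul_assoc)
      then show ?thesis using c by simp
    qed
    ultimately have g0: "g 0 x = 0" if "x \<in> {-l..l}" for x
      using assms(3) that unfolding well_posed_def by blast
    have "g n 0 = 0" for n
    proof -
      have "nderiv {-l..l} n (g 0) 0 = 0"
        by (rule nderiv_eqI[where g = "\<lambda>n x. 0"])
          (use assms(1) g0 in \<open>auto simp: trivial_limit_within\<close>)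
      then show ?thesis using nd[of 0 n] assms(1) by simp
    qed
    then have "Wmat \<alpha> 0 *v c = 0"
      by (simp add: W vec_eq_iff)
    then have "exp_wronskian_inv t 0 *v (Wmat \<alpha> 0 *v c) = 0"
      by simp
    then show "c = 0"
      using assms(2) by (simp add: matrix_vector_mul_assoc Wmat_eq_exp_wronskian t_def exp_wronskian_inv_mult_exp_wronskian)
  qed
  then show ?thesis
    by (metis invertible_left_inverse matrix_left_invertible_ker)
qed

section \<open>Indefinite integrals of integrable functions\<close>

lemma L2_fun_imp_integrable:
  assumes "u \<in> L2_fun l"
  shows "integrable (lebesgue_on {-l..l}) u"
proof (rule Bochner_Integration.integrable_bound)
  show "integrable (lebesgue_on {-l..l}) (\<lambda>x. 1 + (norm (u x))\<^sup>2)"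
    using assms by (auto simp: L2_fun_def intro!: finite_measure.integrable_const finite_measure_lebesgue_on)
  \<comment> \<open>The interval has finite measure, so this bound gives integrability from
    square-integrability.\<close>
  have "t \<le> 1 + t\<^sup>2" for t :: real
    using zero_le_power2[of "t - 1/2"] by (simp add: power2_eq_square algebra_simps)
  then show "AE x in lebesgue_on {-l..l}. norm (u x) \<le> norm (1 + (norm (u x))\<^sup>2)"
    by simp
qed (use assms in \<open>auto simp: L2_fun_def\<close>)

lemma integrable_continuous_mult:
  fixes g u :: "real \<Rightarrow> complex"
  assumes g: "continuous_on {a..b} g" and u: "integrable (lebesgue_on {a..b}) u"
  shows "integrable (lebesgue_on {a..b}) (\<lambda>x. g x * u x)"
proof -
  have "bounded (g ` {a..b})"
    using g by (intro compact_imp_bounded compact_continuous_image) auto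
  then obtain C where C: "\<And>x. x \<in> {a..b} \<Longrightarrow> norm (g x) \<le> C"
    unfolding bounded_iff by blast
  show ?thesis
  proof (rule Bochner_Integration.integrable_bound)
    show "integrable (lebesgue_on {a..b}) (\<lambda>x. C * norm (u x))"
      using u by auto
    show "(\<lambda>x. g x * u x) \<in> borel_measurable (lebesgue_on {a..b})"
      using u continuous_imp_measurable_on_sets_lebesgue[OF g] by auto
    show "AE x in lebesgue_on {a..b}. norm (g x * u x) \<le> norm (C * norm (u x))"
    proof (rule AE_I2)
      fix x assume "x \<in> space (lebesgue_on {a..b})"
      then have "norm (g x) \<le> C" by (intro C) simp
      then show "norm (g x * u x) \<le> norm (C * norm (u x))"
        by (simp add: norm_mult mult_right_mono abs_mult order_trans[OF _ abs_ge_self])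
    qed
  qed
qed

lemma integrable_lebesgue_on_imp_absolutely_integrable:
  fixes f :: "real \<Rightarrow> complex"
  assumes "integrable (lebesgue_on {a..b}) f"
  shows "f absolutely_integrable_on {a..b}"
  using assms by (simp add: set_integrable_def integrable_restrict_space)

lemma AE_lebesgue_on_imp_integral_eq:
  fixes f g :: "real \<Rightarrow> complex"
  assumes "AE x in lebesgue_on {a..b}. f x = g x" "x \<in> {a..b}"
  shows "integral {a..x} f = integral {a..x} g"
proof -
  have "AE x in lebesgue. x \<in> {a..b} \<longrightarrow> f x = g x"
    using assms(1) by (subst (asm) AE_restrict_space_iff) auto
  then obtain N where N: "N \<in> null_sets lebesgue" "{x. \<not> (x \<in> {a..b} \<longrightarrow> f x = g x)} \<subseteq> N"
    by (auto simp: eventually_ae_filter)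
  show ?thesis
    by (rule integral_spike[where S = N]) (use N assms(2) in \<open>auto simp: negligible_iff_null_sets\<close>)
qed

text \<open>The indefinite integral is identically 0, but by continuity its derivative is
  \<open>f\<close>; \<open>a < b\<close> makes one-sided derivatives unique.\<close>

lemma continuous_AE_zero_imp_zero:
  fixes f :: "real \<Rightarrow> complex"
  assumes "a < b" "continuous_on {a..b} f" "AE x in lebesgue_on {a..b}. f x = 0" "x \<in> {a..b}"
  shows "f x = 0"
proof -
  have eq: "integral {a..y} f = 0" if "y \<in> {a..b}" for y
    using AE_lebesgue_on_imp_integral_eq[OF _ that, of f "\<lambda>_. 0"] assms(3) by simp
  have "((\<lambda>y. integral {a..y} f) has_vector_derivative f x) (at x within {a..b})"
    using assms by (intro integral_has_vector_derivative)
  then have "((\<lambda>y. 0) has_vector_derivative f x) (at x within {a..b})"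
    by (rule has_vector_derivative_transform[rotated 2]) (use eq assms(4) in auto)
  moreover have "((\<lambda>y. 0::complex) has_vector_derivative 0) (at x within {a..b})"
    by simp
  ultimately show ?thesis
    using vector_derivative_unique_within_closed_interval[of a b x "\<lambda>_. 0" "f x" 0] assms(1,4) by simp
qed

lemma norm_integral_diff_le:
  fixes f :: "real \<Rightarrow> complex" and g :: "real \<Rightarrow> real"
  assumes f: "f integrable_on {a..b}" and g: "g integrable_on {a..b}"
    and x: "x \<in> {a..b}" and z: "z \<in> {a..b}"
    and le: "\<And>t. t \<in> {min x z..max x z} \<Longrightarrow> norm (f t) \<le> g t"
  shows "norm (integral {a..z} f - integral {a..x} f) \<le> \<bar>integral {a..z} g - integral {a..x} g\<bar>"
proof -
  define c d where "c = min x z" and "d = max x z"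
  have cd: "a \<le> c" "c \<le> d" "d \<le> b"
    using x z by (auto simp: c_def d_def)
  have sub: "f integrable_on {p..q}" "g integrable_on {p..q}" if "a \<le> p" "q \<le> b" for p q
    using f g that by (auto intro: integrable_subinterval_real)
  have "integral {a..c} f + integral {c..d} f = integral {a..d} f"
       "integral {a..c} g + integral {c..d} g = integral {a..d} g"
    using cd sub by (intro Henstock_Kurzweil_Integration.integral_combine; auto)+
  moreover have "norm (integral {c..d} f) \<le> integral {c..d} g"
    using sub cd le by (intro integral_norm_bound_integral) (auto simp: c_def d_def)
  moreover have "norm (p' - p) \<le> \<bar>q' - q\<bar>"
    if "p + r = p'" "q + s = q'" "norm r \<le> s" for p p' r :: complex and q q' s :: real
    using that by auto
  ultimately have "norm (integral {a..d} f - integral {a..c} f) \<le> \<bar>integral {a..d} g - integral {a..c} g\<bar>"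
    by blast
  then show ?thesis
    by (cases "x \<le> z") (simp_all add: c_def d_def norm_minus_commute abs_minus_commute)
qed

section \<open>Differentiation of sums with merely continuous factors\<close>

lemma has_vector_derivative_zeroI:
  fixes f :: "real \<Rightarrow> 'a::real_normed_vector"
  assumes le: "eventually (\<lambda>z. norm (f z - f x) \<le> \<bar>z - x\<bar> * e z) (at x within S)"
    and e: "(e \<longlongrightarrow> 0) (at x within S)"
  shows "(f has_vector_derivative 0) (at x within S)"
  unfolding has_vector_derivative_def has_derivative_within
proof
  show "((\<lambda>y. (1 / norm (y - x)) *\<^sub>R (f y - (f x + (y - x) *\<^sub>R 0))) \<longlongrightarrow> 0) (at x within S)"
  proof (rule Lim_null_comparison[OF _ e])
    have "eventually (\<lambda>z. z \<noteq> x) (at x within S)"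
      by (simp add: eventually_at_filter)
    with le show "eventually (\<lambda>y. norm ((1 / norm (y - x)) *\<^sub>R (f y - (f x + (y - x) *\<^sub>R 0))) \<le> e y) (at x within S)"
      by eventually_elim (simp only: norm_scaleR, simp add: pos_divide_le_eq mult.commute)
  qed
qed simp

lemma has_vector_derivative_imp_locally_Lipschitz:
  fixes f :: "real \<Rightarrow> 'a::real_normed_vector"
  assumes "(f has_vector_derivative d) (at x within S)"
  shows "eventually (\<lambda>z. norm (f z - f x) \<le> \<bar>z - x\<bar> * (norm d + 1)) (at x within S)"
proof -
  have "((\<lambda>y. (1 / norm (y - x)) *\<^sub>R (f y - (f x + (y - x) *\<^sub>R d))) \<longlongrightarrow> 0) (at x within S)"
    using assms by (simp add: has_vector_derivative_def has_derivative_within)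
  then have "eventually (\<lambda>y. norm ((1 / norm (y - x)) *\<^sub>R (f y - (f x + (y - x) *\<^sub>R d))) < 1) (at x within S)"
    using tendstoD[of _ 0 _ 1] by (fastforce simp: dist_norm)
  moreover have "eventually (\<lambda>z. z \<noteq> x) (at x within S)"
    by (simp add: eventually_at_filter)
  ultimately show ?thesis
  proof eventually_elim
    case (elim z)
    from elim(1) have "norm (f z - (f x + (z - x) *\<^sub>R d)) < \<bar>z - x\<bar>"
      using elim(2) by (simp only: norm_scaleR) (simp add: pos_divide_less_eq)
    then have "norm ((f z - f x) - (z - x) *\<^sub>R d) \<le> \<bar>z - x\<bar>"
      by (simp add: diff_diff_eq)
    moreover have "norm (f z - f x) \<le> norm ((f z - f x) - (z - x) *\<^sub>R d) + norm ((z - x) *\<^sub>R d)"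
      using norm_triangle_ineq[of "(f z - f x) - (z - x) *\<^sub>R d" "(z - x) *\<^sub>R d"] by simp
    ultimately show ?case
      by (simp only: norm_scaleR real_norm_def distrib_left mult_1_right)
  qed
qed

text \<open>
  As \<open>u\<close> is only integrable, the single integrals need not be differentiable. The sum is, because the
  kernel \<open>\<Sum>q. A q x * B q t\<close> vanishes at \<open>t = x\<close> and so is \<open>O(\<bar>t - x\<bar>)\<close>.
\<close>

lemma has_vector_derivative_sum_mult_integral:
  fixes A B :: "'i::finite \<Rightarrow> real \<Rightarrow> complex"
  assumes x: "x \<in> {a..b}" and u: "integrable (lebesgue_on {a..b}) u"
    and A: "\<And>q. (A q has_vector_derivative A' q) (at x within {a..b})"
    and B: "\<And>q. (B q has_vector_derivative B' q) (at x within {a..b})"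
    and contB: "\<And>q. continuous_on {a..b} (B q)"
    and zero: "(\<Sum>q\<in>UNIV. A q x * B q x) = 0"
  shows "((\<lambda>z. \<Sum>q\<in>UNIV. A q z * (c q - integral {a..z} (\<lambda>t. B q t * u t))) has_vector_derivative
    (\<Sum>q\<in>UNIV. A' q * (c q - integral {a..x} (\<lambda>t. B q t * u t)))) (at x within {a..b})"
proof -
  define v where "v q z = c q - integral {a..z} (\<lambda>t. B q t * u t)" for q z
  let ?at = "at x within {a..b}"
  have int: "(\<lambda>t. B q t * u t) integrable_on {a..b}" for q
    using integrable_lebesgue_on_imp_absolutely_integrable[OF integrable_continuous_mult[OF contB u]]
    by (simp add: absolutely_integrable_on_def)
  have v_lim: "((\<lambda>z. v q z - v q x) \<longlongrightarrow> 0) ?at" for q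
  proof -
    have "continuous_on {a..b} (v q)"
      unfolding v_def by (intro continuous_intros indefinite_integral_continuous_1 int)
    then show ?thesis
      using x by (simp add: continuous_on LIM_zero)
  qed
  \<comment> \<open>A(z) v(z) is split as A(z) v(x) + (A(z) - A(x)) (v(z) - v(x)) + A(x) (v(z) -
    v(x)). Only the first part contributes to the derivative; the second is a Lipschitz increment
    times a null function.\<close>
  have 1: "((\<lambda>z. \<Sum>q\<in>UNIV. A q z * v q x) has_vector_derivative (\<Sum>q\<in>UNIV. A' q * v q x)) ?at"
    by (intro has_vector_derivative_sum has_vector_derivative_mult_left A)
  have 2: "((\<lambda>z. \<Sum>q\<in>UNIV. (A q z - A q x) * (v q z - v q x)) has_vector_derivative (\<Sum>q\<in>(UNIV::'i set). 0)) ?at"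
  proof (rule has_vector_derivative_sum)
    fix q
    show "((\<lambda>z. (A q z - A q x) * (v q z - v q x)) has_vector_derivative 0) ?at"
    proof (rule has_vector_derivative_zeroI)
      show "eventually (\<lambda>z. norm ((A q z - A q x) * (v q z - v q x) - (A q x - A q x) * (v q x - v q x)) \<le>
          \<bar>z - x\<bar> * ((norm (A' q) + 1) * norm (v q z - v q x))) ?at"
        using has_vector_derivative_imp_locally_Lipschitz[OF A[of q]]
      proof eventually_elim
        case (elim z)
        then show ?case
          using mult_right_mono[OF elim, of "norm (v q z - v q x)"] by (simp add: norm_mult mult.assoc)
      qed
      show "((\<lambda>z. (norm (A' q) + 1) * norm (v q z - v q x)) \<longlongrightarrow> 0) ?at"
        by (intro tendsto_mult_right_zero tendsto_norm_zero v_lim)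
    qed
  qed
  \<comment> \<open>\<open>\<beta>\<close> is the kernel with \<open>x\<close> frozen in
    \<open>A\<close>. It vanishes at \<open>x\<close> by \<open>zero\<close>, so near
    \<open>x\<close> it is at most C |t - x|, and the third part is at most C |z - x| times the
    integral of |u| between \<open>x\<close> and \<open>z\<close>.\<close>
  define \<beta> where "\<beta> t = (\<Sum>q\<in>UNIV. A q x * B q t)" for t
  define C where "C = norm (\<Sum>q\<in>UNIV. A q x * B' q) + 1"
  define N where "N z = integral {a..z} (\<lambda>t. norm (u t))" for z
  have intN: "(\<lambda>t. norm (u t)) integrable_on {a..b}"
    using integrable_lebesgue_on_imp_absolutely_integrable[OF u] by (simp add: absolutely_integrable_on_def)
  have 3: "((\<lambda>z. \<Sum>q\<in>UNIV. A q x * (v q z - v q x)) has_vector_derivative 0) ?at"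
  proof (rule has_vector_derivative_zeroI)
    have eq: "(\<Sum>q\<in>UNIV. A q x * (v q z - v q x)) =
        - (integral {a..z} (\<lambda>t. \<beta> t * u t) - integral {a..x} (\<lambda>t. \<beta> t * u t))"
      if z: "z \<in> {a..b}" for z
    proof -
      have "integral {a..y} (\<lambda>t. \<beta> t * u t) = (\<Sum>q\<in>UNIV. A q x * integral {a..y} (\<lambda>t. B q t * u t))"
        if "y \<in> {a..b}" for y
      proof -
        have "(\<lambda>t. B q t * u t) integrable_on {a..y}" for q
          by (rule integrable_subinterval_real[OF int]) (use that in auto)
        then show ?thesis
          unfolding \<beta>_def sum_distrib_right mult.assoc
          by (subst integral_sum) (auto intro: integrable_on_mult_right)
      qed
      with z x show ?thesis
        by (simp add: v_def sum_subtractf[symmetric] sum_negf[symmetric] algebra_simps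
            del: sum_subtractf sum_negf)
    qed
    have "(\<beta> has_vector_derivative (\<Sum>q\<in>UNIV. A q x * B' q)) ?at"
      unfolding \<beta>_def by (intro has_vector_derivative_sum has_vector_derivative_mult_right B)
    then have "eventually (\<lambda>z. norm (\<beta> z - \<beta> x) \<le> \<bar>z - x\<bar> * C) ?at"
      unfolding C_def by (rule has_vector_derivative_imp_locally_Lipschitz)
    then obtain \<delta> where \<delta>: "\<delta> > 0" "\<And>z. z \<in> {a..b} \<Longrightarrow> dist z x < \<delta> \<Longrightarrow> norm (\<beta> z) \<le> \<bar>z - x\<bar> * C"
      using zero unfolding eventually_at \<beta>_def by fastforce
    have int\<beta>: "(\<lambda>t. \<beta> t * u t) integrable_on {a..b}"
      using int unfolding \<beta>_def sum_distrib_right mult.assoc by (intro integrable_sum integrable_on_mult_right) auto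
    show "eventually (\<lambda>z. norm ((\<Sum>q\<in>UNIV. A q x * (v q z - v q x)) - (\<Sum>q\<in>UNIV. A q x * (v q x - v q x))) \<le>
        \<bar>z - x\<bar> * (C * \<bar>N z - N x\<bar>)) ?at"
      unfolding eventually_at
    proof (intro exI[of _ \<delta>] conjI ballI impI)
      fix z assume z: "z \<in> {a..b}" "z \<noteq> x \<and> dist z x < \<delta>"
      have "norm (integral {a..z} (\<lambda>t. \<beta> t * u t) - integral {a..x} (\<lambda>t. \<beta> t * u t)) \<le>
          \<bar>integral {a..z} (\<lambda>t. \<bar>z - x\<bar> * C * norm (u t)) - integral {a..x} (\<lambda>t. \<bar>z - x\<bar> * C * norm (u t))\<bar>"
      proof (rule norm_integral_diff_le[OF int\<beta> _ x z(1)])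
        fix t assume t: "t \<in> {min x z..max x z}"
        have "norm (\<beta> t) \<le> \<bar>t - x\<bar> * C"
          using t x z by (intro \<delta>(2)) (auto simp: dist_real_def)
        also have "\<dots> \<le> \<bar>z - x\<bar> * C"
          using t by (intro mult_right_mono) (auto simp: C_def)
        finally show "norm (\<beta> t * u t) \<le> \<bar>z - x\<bar> * C * norm (u t)"
          by (simp add: norm_mult mult_right_mono)
      qed (intro integrable_on_mult_right intN)
      also have "\<dots> = \<bar>z - x\<bar> * (C * \<bar>N z - N x\<bar>)"
        by (simp add: N_def abs_mult C_def flip: right_diff_distrib)
      finally show "norm ((\<Sum>q\<in>UNIV. A q x * (v q z - v q x)) - (\<Sum>q\<in>UNIV. A q x * (v q x - v q x))) \<le>
        \<bar>z - x\<bar> * (C * \<bar>N z - N x\<bar>)"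
        by (simp only: eq[OF z(1)] norm_minus_cancel) (simp add: norm_minus_commute)
    qed (fact \<delta>)
    have "continuous_on {a..b} N"
      unfolding N_def by (rule indefinite_integral_continuous_1[OF intN])
    then have "((\<lambda>z. N z - N x) \<longlongrightarrow> 0) ?at"
      using x by (simp add: continuous_on LIM_zero)
    then show "((\<lambda>z. C * \<bar>N z - N x\<bar>) \<longlongrightarrow> 0) ?at"
      by (intro tendsto_mult_right_zero tendsto_rabs_zero)
  qed
  have "((\<lambda>z. (\<Sum>q\<in>UNIV. A q z * v q x) + (\<Sum>q\<in>UNIV. (A q z - A q x) * (v q z - v q x)) +
      (\<Sum>q\<in>UNIV. A q x * (v q z - v q x))) has_vector_derivative (\<Sum>q\<in>UNIV. A' q * v q x) + (\<Sum>q\<in>(UNIV::'i set). 0) + 0) ?at"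
    by (intro has_vector_derivative_add 1 2 3)
  moreover have "(\<Sum>q\<in>UNIV. A q z * v q x) + (\<Sum>q\<in>UNIV. (A q z - A q x) * (v q z - v q x)) +
      (\<Sum>q\<in>UNIV. A q x * (v q z - v q x)) = (\<Sum>q\<in>UNIV. A q z * v q z)" for z
    by (simp add: sum.distrib[symmetric] algebra_simps del: sum.distrib)
  ultimately show ?thesis
    by (simp add: v_def)
qed

section \<open>Boundary matrices\<close>

lemma diag_mult_vec: "(diag d *v w) $ i = d $ i * w $ i"
  by (simp add: diag_def matrix_vector_mult_def if_distrib[of "\<lambda>z. z * _"] cong: if_cong)

text \<open>\<open>Lsq\<close> exchanges the indices q and q + 2, and
  \<open>om (q + 2) = - om q\<close>, so the exponents change sign. As 1 / om q ^ 3 = - om q, the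
  result is a constant multiple of the last column of W(t)^-1, the kernel of variation of
  constants.\<close>

lemma Omega_Lsq_mult_yvec:
  "(Omega ** Lsq) *v yvec \<alpha> t = (\<chi> q. om q * exp (- (om q * of_real \<alpha> * of_real t)))"
  unfolding matrix_vector_mul_assoc[symmetric] vec_eq_iff forall_4 Omega_def diag_mult_vec
  by (simp add: Lsq_def matrix_vector_mult_def sum_4 vector4_nth yvec_def,
      simp add: om_simps[simplified])

lemma Omega_Lsq_inv: "(Omega ** Lsq) ** matrix_inv (Omega ** Lsq) = mat 1"
proof -
  \<comment> \<open>\<open>Lsq\<close> is an involution, and \<open>Omega\<close> is diagonal with
    nonzero entries.\<close>
  have "(Omega ** Lsq) ** (Lsq ** diag (\<chi> j. 1 / om j)) = mat 1"
    unfolding vec_eq_iff forall_4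
    by (simp add: Omega_def Lsq_def diag_def matrix_matrix_mult_def sum_4 vector4_nth mat_def)
  then show ?thesis
    using matrix_inv_unique by metis
qed

section \<open>The boundary matrix Q\<close>

abbreviation sqrt2 :: complex where "sqrt2 \<equiv> of_real (sqrt 2)"

lemma omega_1: "omega 1 = Complex (sqrt 2 / 2) (sqrt 2 / 2)"
  by (simp add: omega_conv_cis complex_eq_iff cos_45 sin_45)

text \<open>The rows of \<open>Qmat\<close>, applied to an exponential with exponent \<open>om q * \<alpha>\<close>, give these cubics in \<open>om q\<close>
  up to a factor \<open>\<alpha>^3\<close>.\<close>

lemma Q_row_polys:
  "om 1 - sqrt2 * om 1 ^ 2 + om 1 ^ 3 = 0" "om 2 - sqrt2 * om 2 ^ 2 + om 2 ^ 3 = 2 * sqrt2 * \<i>"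
  "om 3 - sqrt2 * om 3 ^ 2 + om 3 ^ 3 = - (2 * sqrt2 * \<i>)" "om 4 - sqrt2 * om 4 ^ 2 + om 4 ^ 3 = 0"
  "sqrt2 - om 1 + om 1 ^ 3 = 0" "sqrt2 - om 2 + om 2 ^ 3 = 2 * sqrt2"
  "sqrt2 - om 3 + om 3 ^ 3 = 2 * sqrt2" "sqrt2 - om 4 + om 4 ^ 3 = 0"
  "om 1 + sqrt2 * om 1 ^ 2 + om 1 ^ 3 = 2 * sqrt2 * \<i>" "om 2 + sqrt2 * om 2 ^ 2 + om 2 ^ 3 = 0"
  "om 3 + sqrt2 * om 3 ^ 2 + om 3 ^ 3 = 0" "om 4 + sqrt2 * om 4 ^ 2 + om 4 ^ 3 = - (2 * sqrt2 * \<i>)"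
  "- sqrt2 - om 1 + om 1 ^ 3 = - (2 * sqrt2)" "- sqrt2 - om 2 + om 2 ^ 3 = 0"
  "- sqrt2 - om 3 + om 3 ^ 3 = 0" "- sqrt2 - om 4 + om 4 ^ 3 = - (2 * sqrt2)"
  unfolding om_simps
  by (simp_all add: omega_1 complex_eq_iff power2_eq_square power3_eq_cube field_simps)

lemma Mt_Q_rows:
  fixes \<alpha> l :: real
  defines "e q \<equiv> exp (om q * of_real \<alpha> * of_real l)"
    and "e' q \<equiv> exp (- (om q * of_real \<alpha> * of_real l))"
  shows "Mt_minus l \<alpha> (Qmat \<alpha>) $ 1 $ q = of_real \<alpha> ^ 3 * (om q - sqrt2 * om q ^ 2 + om q ^ 3) * e' q"
    "Mt_minus l \<alpha> (Qmat \<alpha>) $ 2 $ q = of_real \<alpha> ^ 3 * (sqrt2 - om q + om q ^ 3) * e' q"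
    "Mt_minus l \<alpha> (Qmat \<alpha>) $ 3 $ q = 0"
    "Mt_minus l \<alpha> (Qmat \<alpha>) $ 4 $ q = 0"
    "Mt_plus l \<alpha> (Qmat \<alpha>) $ 1 $ q = 0"
    "Mt_plus l \<alpha> (Qmat \<alpha>) $ 2 $ q = 0"
    "Mt_plus l \<alpha> (Qmat \<alpha>) $ 3 $ q = of_real \<alpha> ^ 3 * (om q + sqrt2 * om q ^ 2 + om q ^ 3) * e q"
    "Mt_plus l \<alpha> (Qmat \<alpha>) $ 4 $ q = of_real \<alpha> ^ 3 * (- sqrt2 - om q + om q ^ 3) * e q"
  by (simp_all add: Mt_minus_def Mt_plus_def left_block_def right_block_def Qmat_def join_blocks_def
      Wmat_def matrix_matrix_mult_def sum_4 vector4_nth e_def e'_def power2_eq_square power3_eq_cube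
      algebra_simps)

text \<open>The left cubics contain the factor z^2 - sqrt 2 z + 1 with roots om 1, om 4, and the
  right ones z^2 + sqrt 2 z + 1 with roots om 2, om 3. So \<open>Mt\<close> agrees with
  \<open>Mt_plus\<close> in columns 1 and 4, while \<open>Mt_plus\<close> vanishes in columns 2 and
  3.\<close>

lemma Mt_Q_mult_diag:
  "Mt l \<alpha> (Qmat \<alpha>) ** diag (vector [1, 0, 0, 1]) = Mt_plus l \<alpha> (Qmat \<alpha>)"
  unfolding vec_eq_iff forall_4
  by (simp add: matrix_matrix_mult_def sum_4 Mt_def Mt_Q_rows diag_def vector4_nth Q_row_polys del: pos_simps)

text \<open>The vanishing cubics decouple Mt c = 0 into two systems, one for components 2 and 3, one
  for 1 and 4; each makes a sum and a difference zero.\<close>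

lemma invertible_Mt_Q:
  assumes "\<alpha> > 0"
  shows "invertible (Mt l \<alpha> (Qmat \<alpha>))"
proof -
  have "c = 0" if c: "Mt l \<alpha> (Qmat \<alpha>) *v c = 0" for c
  proof -
    define e where "e q = exp (om q * of_real \<alpha> * of_real l) * c $ q" for q
    define e' where "e' q = exp (- (om q * of_real \<alpha> * of_real l)) * c $ q" for q
    have "(Mt l \<alpha> (Qmat \<alpha>) *v c) $ 1 = of_real \<alpha> ^ 3 * 2 * sqrt2 * \<i> * (e' 2 - e' 3)"
      "(Mt l \<alpha> (Qmat \<alpha>) *v c) $ 2 = of_real \<alpha> ^ 3 * 2 * sqrt2 * (e' 2 + e' 3)"
      "(Mt l \<alpha> (Qmat \<alpha>) *v c) $ 3 = of_real \<alpha> ^ 3 * 2 * sqrt2 * \<i> * (e 1 - e 4)"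
      "(Mt l \<alpha> (Qmat \<alpha>) *v c) $ 4 = - (of_real \<alpha> ^ 3 * 2 * sqrt2 * (e 1 + e 4))"
      by (simp_all only: matrix_vector_mult_def vec_lambda_beta sum_4 Mt_def vector_add_component
          Mt_Q_rows Q_row_polys)
        (simp_all only: e_def e'_def, simp_all add: algebra_simps del: pos_simps)
    with c have "of_real \<alpha> ^ 3 * 2 * sqrt2 * \<i> * (e' 2 - e' 3) = 0" "of_real \<alpha> ^ 3 * 2 * sqrt2 * (e' 2 + e' 3) = 0"
      "of_real \<alpha> ^ 3 * 2 * sqrt2 * \<i> * (e 1 - e 4) = 0" "of_real \<alpha> ^ 3 * 2 * sqrt2 * (e 1 + e 4) = 0"
      by simp_all
    then have "e' 2 = e' 3" "e' 2 + e' 3 = 0" "e 1 = e 4" "e 1 + e 4 = 0"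
      using assms by simp_all
    then have "e' 2 = 0" "e' 3 = 0" "e 1 = 0" "e 4 = 0"
      by simp_all
    then show ?thesis
      by (simp add: vec_eq_iff forall_4 e_def e'_def)
  qed
  then show ?thesis
    by (metis invertible_left_inverse matrix_left_invertible_ker)
qed

lemma matrix_inv_left: "invertible A \<Longrightarrow> matrix_inv A ** A = mat 1" for A :: "'a::semiring_1^'n^'n"
  unfolding invertible_def matrix_inv_def by (metis (mono_tags, lifting) someI_ex)

section \<open>Reduction of all boundary matrices to S\<close>

text \<open>The S of the overview: \<open>G_plus\<close> is S \<open>Omega\<close>
  \<open>Lsq\<close> and, for invertible \<open>Mt\<close>, \<open>G_minus\<close> is (1 - S)
  \<open>Omega\<close> \<open>Lsq\<close>.\<close>

definition plus_part :: "real \<Rightarrow> real \<Rightarrow> complex^(4 + 4)^4 \<Rightarrow> complex^4^4" where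
  "plus_part l \<alpha> M = matrix_inv (Mt l \<alpha> M) ** Mt_plus l \<alpha> M"

lemma plus_part_Q: "\<alpha> > 0 \<Longrightarrow> plus_part l \<alpha> (Qmat \<alpha>) = diag (vector [1, 0, 0, 1])"
  by (simp add: plus_part_def matrix_mul_assoc matrix_inv_left invertible_Mt_Q flip: Mt_Q_mult_diag)

lemma G_plus_mult_vec: "G_plus l \<alpha> M *v w = plus_part l \<alpha> M *v ((Omega ** Lsq) *v w)"
  by (simp add: G_plus_def plus_part_def matrix_vector_mul_assoc matrix_mul_assoc)

lemma G_minus_mult_vec:
  assumes "invertible (Mt l \<alpha> M)"
  shows "G_minus l \<alpha> M *v w = (Omega ** Lsq) *v w - plus_part l \<alpha> M *v ((Omega ** Lsq) *v w)"
proof -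
  define z where "z = (Omega ** Lsq) *v w"
  have "Mt_minus l \<alpha> M *v z = Mt l \<alpha> M *v z - Mt_plus l \<alpha> M *v z"
    by (simp add: Mt_def matrix_vector_mult_add_rdistrib)
  then have "matrix_inv (Mt l \<alpha> M) *v (Mt_minus l \<alpha> M *v z) = z - plus_part l \<alpha> M *v z"
    by (simp add: matrix_vector_mult_diff_distrib matrix_vector_mul_assoc matrix_inv_left assms plus_part_def)
  then show ?thesis
    by (simp add: z_def G_minus_def matrix_vector_mul_assoc matrix_mul_assoc)
qed

text \<open>With P = diag(1,0,0,1) and N = diag(0,1,1,0), X(l) c = N a + P b, and P is the S of Q.
  Thus the \<open>Gmat\<close> term is (S - P)(b - a), and P + N = 1 leaves a + S (b - a).\<close>

lemma boundary_condition_eq: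
  fixes l \<alpha> k :: real and lam :: complex and c :: "complex^4"
  assumes "\<alpha> > 0"
  defines "a \<equiv> exp_wronskian_inv (of_real \<alpha>) (- l) *v (Wl \<alpha> k lam (- l) *v c)"
    and "b \<equiv> exp_wronskian_inv (of_real \<alpha>) l *v (Wl \<alpha> k lam l *v c)"
  shows "(Gmat l \<alpha> M ** (Xl \<alpha> k lam l - Xl \<alpha> k lam (- l)) + Xl \<alpha> k lam l) *v c =
    a + plus_part l \<alpha> M *v (b - a)"
proof -
  let ?P = "diag (vector [1, 0, 0, 1])" and ?N = "diag (vector [0, 1, 1, 0])"
  have X: "Xl \<alpha> k lam l *v c = ?N *v a + ?P *v b" "Xl \<alpha> k lam (- l) *v c = ?N *v b + ?P *v a"
    using assms(1) by (simp_all add: Xl_def matrix_vector_mult_add_rdistrib matrix_inv_Wmat a_def b_def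
        matrix_vector_mul_assoc matrix_mul_assoc)
  \<comment> \<open>The difference in the argument is (P - N)(b - a), and \<open>Eps\<close> = P - N
    squares to 1.\<close>
  have eps: "Eps *v ((?N *v a + ?P *v b) - (?N *v b + ?P *v a)) = b - a"
    unfolding vec_eq_iff forall_4 by (simp add: Eps_def diag_mult_vec vector4_nth)
  define w where "w = matrix_inv (Omega ** Lsq) *v (b - a)"
  have w: "(Omega ** Lsq) *v w = b - a"
    by (simp add: w_def matrix_vector_mul_assoc Omega_Lsq_inv)
  have "Gmat l \<alpha> M *v ((Xl \<alpha> k lam l - Xl \<alpha> k lam (- l)) *v c) = G_plus l \<alpha> M *v w - G_plus l \<alpha> (Qmat \<alpha>) *v w"
    by (simp add: Gmat_def matrix_vector_mult_diff_rdistrib X eps w_def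
        flip: matrix_vector_mul_assoc)
  also have "\<dots> = plus_part l \<alpha> M *v (b - a) - ?P *v (b - a)"
    using assms(1) by (simp add: G_plus_mult_vec w plus_part_Q)
  finally have "(Gmat l \<alpha> M ** (Xl \<alpha> k lam l - Xl \<alpha> k lam (- l)) + Xl \<alpha> k lam l) *v c =
      plus_part l \<alpha> M *v (b - a) - ?P *v (b - a) + (?N *v a + ?P *v b)"
    by (simp add: matrix_vector_mult_add_rdistrib X flip: matrix_vector_mul_assoc)
  also have "\<dots> = a + plus_part l \<alpha> M *v (b - a)"
    unfolding vec_eq_iff forall_4 by (simp add: diag_mult_vec vector4_nth)
  finally show ?thesis .
qed

lemma Gmat_Q: "Gmat l \<alpha> (Qmat \<alpha>) = 0"
  by (simp add: Gmat_def)

section \<open>The integral operator\<close>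

text \<open>The integrand is \<open>Omega ** Lsq\<close> applied to y(t), times u(t), in the form of
  \<open>Omega_Lsq_mult_yvec\<close>.\<close>

definition int_vec :: "real \<Rightarrow> real \<Rightarrow> (real \<Rightarrow> complex) \<Rightarrow> real \<Rightarrow> complex^4" where
  "int_vec l \<alpha> u x =
    (\<chi> q. integral {-l..x} (\<lambda>t. om q * exp (- (om q * of_real \<alpha> * of_real t)) * u t))"

definition coeff_vec :: "real \<Rightarrow> real \<Rightarrow> complex^4^4 \<Rightarrow> complex \<Rightarrow> (real \<Rightarrow> complex) \<Rightarrow> real \<Rightarrow> complex^4" where
  "coeff_vec l \<alpha> S a u x = a *s (S *v int_vec l \<alpha> u l - int_vec l \<alpha> u x)"

lemma K_op_eq:
  assumes inv: "invertible (Mt l \<alpha> M)" and u: "integrable (lebesgue_on {-l..l}) u" and x: "x \<in> {-l..l}"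
  shows "K_op l \<alpha> k M u x =
    (Wmat \<alpha> x *v coeff_vec l \<alpha> (plus_part l \<alpha> M) (of_real (\<alpha> / (4 * k))) u x) $ 1"
proof -
  let ?S = "plus_part l \<alpha> M" and ?L = "lebesgue_on {-l..l}"
  define a where "a = complex_of_real (\<alpha> / (4 * k))"
  define z where "z t = (Omega ** Lsq) *v yvec \<alpha> t" for t
  have z: "z t $ q = om q * exp (- (om q * of_real \<alpha> * of_real t))" for t q
    by (simp add: z_def Omega_Lsq_mult_yvec)
  have intz: "integrable ?L (\<lambda>t. z t $ q * u t)" for q
    unfolding z by (intro integrable_continuous_mult u continuous_intros)
  have hb1: "has_bochner_integral ?L (\<lambda>t. z t $ q * u t) (int_vec l \<alpha> u l $ q)" for q
    using intz[of q] lebesgue_integral_eq_integral[OF intz[of q]]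
    by (simp add: has_bochner_integral_iff int_vec_def z)
  \<comment> \<open>The cutoff is strict because \<open>Green\<close> takes its first branch at
    \<open>x = t\<close>; the single point does not change the integral.\<close>
  have hb2: "has_bochner_integral ?L (\<lambda>t. (if t < x then z t $ q else 0) * u t) (int_vec l \<alpha> u x $ q)" for q
  proof -
    have abs: "(\<lambda>t. z t $ q * u t) absolutely_integrable_on {-l..l}"
      by (rule integrable_lebesgue_on_imp_absolutely_integrable[OF intz])
    have sub: "set_integrable lebesgue {-l..<x} (\<lambda>t. z t $ q * u t)"
      by (rule set_integrable_subset[OF abs]) (use x in auto)
    have eq: "indicator {-l..l} t *\<^sub>R ((if t < x then z t $ q else 0) * u t) =
        indicator {-l..<x} t *\<^sub>R (z t $ q * u t)" for t
      using x by (auto split: split_indicator)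
    have "integral {-l..<x} (\<lambda>t. z t $ q * u t) = integral {-l..x} (\<lambda>t. z t $ q * u t)"
      by (rule integral_spike_set; rule negligible_subset[of "{x}"]) auto
    with sub set_lebesgue_integral_eq_integral(2)[OF sub] show ?thesis
      by (simp add: has_bochner_integral_iff integrable_restrict_space integral_restrict_space
          set_integrable_def set_lebesgue_integral_def eq int_vec_def z)
  qed
  \<comment> \<open>Both branches of the Green's function are a y(x)^T (S z(t) - [t < x] z(t)),
    which integrates to a y(x)^T (S int(l) - int(x)).\<close>
  define g where "g t = (\<Sum>p\<in>UNIV. a * yvec \<alpha> x $ p *
      ((\<Sum>q\<in>UNIV. ?S $ p $ q * (z t $ q * u t)) - (if t < x then z t $ p else 0) * u t))" for t
  have "Green l \<alpha> k M x t * u t = g t" for t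
  proof -
    have "(\<Sum>q\<in>UNIV. ?S $ p $ q * (z t $ q * u t)) = (?S *v z t) $ p * u t" for p
      by (simp add: matrix_vector_mult_def sum_distrib_right mult.assoc)
    then have g: "g t = (\<Sum>p\<in>UNIV. a * yvec \<alpha> x $ p * ((?S *v z t) $ p * u t - (if t < x then z t $ p else 0) * u t))"
      by (simp only: g_def)
    show ?thesis
    proof (cases "x \<le> t")
      case True
      then have "Green l \<alpha> k M x t = a * (\<Sum>p\<in>UNIV. yvec \<alpha> x $ p * (?S *v z t) $ p)"
        by (simp only: Green_def G_plus_mult_vec tdot_def a_def if_True flip: z_def)
      with True show ?thesis
        by (simp add: g sum_distrib_left sum_distrib_right mult.assoc)
    next
      case False
      then have "Green l \<alpha> k M x t = - a * (\<Sum>p\<in>UNIV. yvec \<alpha> x $ p * (z t - ?S *v z t) $ p)"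
        by (simp only: Green_def G_minus_mult_vec[OF inv] tdot_def a_def if_False flip: z_def)
      with False show ?thesis
        unfolding g by (simp only: sum_distrib_left sum_distrib_right, intro sum.cong) (simp_all add: algebra_simps)
    qed
  qed
  then have "K_op l \<alpha> k M u x = (LINT t|?L. g t)"
    by (simp add: K_op_def)
  also have "\<dots> = (\<Sum>p\<in>UNIV. a * yvec \<alpha> x $ p *
      ((\<Sum>q\<in>UNIV. ?S $ p $ q * int_vec l \<alpha> u l $ q) - int_vec l \<alpha> u x $ p))"
    unfolding g_def
    by (intro has_bochner_integral_integral_eq has_bochner_integral_sum has_bochner_integral_mult_right
        has_bochner_integral_diff hb1 hb2)
  also have "\<dots> = tdot (yvec \<alpha> x) (coeff_vec l \<alpha> ?S a u x)"
    by (simp add: tdot_def coeff_vec_def matrix_vector_mult_def algebra_simps)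
  finally show ?thesis
    by (simp add: tdot_yvec a_def)
qed

section \<open>Derivatives of the image under the integral operator\<close>

lemma om_power_sums: "(\<Sum>q\<in>UNIV. om q) = 0" "(\<Sum>q\<in>UNIV. om q ^ 2) = 0" "(\<Sum>q\<in>UNIV. om q ^ 3) = 0"
  unfolding sum_4 om_simps by (simp_all add: power_mult_distrib power2_eq_square power3_eq_cube)

lemma exp_mult_exp_neg: "exp z * exp (- z) = (1 :: complex)"
  by (simp flip: exp_add)

lemma coeff_vec_nth:
  "coeff_vec l \<alpha> S a u x $ q = a * (S *v int_vec l \<alpha> u l) $ q -
    integral {-l..x} (\<lambda>t. a * (om q * exp (- (om q * of_real \<alpha>) * of_real t)) * u t)"
  by (simp add: coeff_vec_def int_vec_def right_diff_distrib mult.assoc flip: integral_mult_right)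

lemma Wmat_mult_nth:
  "(Wmat \<alpha> x *v v) $ p = (\<Sum>q\<in>UNIV. (om q * of_real \<alpha>) ^ (pos p - 1) * exp (om q * of_real \<alpha> * of_real x) * v $ q)"
  by (simp add: Wmat_def matrix_vector_mult_def)

text \<open>The kernel of the n-th derivative has diagonal value a \<alpha>^n times the sum of
  \<open>om q ^ Suc n\<close>, which is 0 for n < 3. Hence no continuity of \<open>u\<close> is
  required below order four.\<close>

lemma has_vector_derivative_Wmat_coeff_vec:
  assumes u: "integrable (lebesgue_on {-l..l}) u" and x: "x \<in> {-l..l}" and p: "p \<noteq> 4"
  shows "((\<lambda>x. (Wmat \<alpha> x *v coeff_vec l \<alpha> S a u x) $ p) has_vector_derivative
    (Wmat \<alpha> x *v coeff_vec l \<alpha> S a u x) $ (p + 1)) (at x within {-l..l})"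
proof -
  define n where "n = pos p - 1"
  have n: "n < 3" "pos (p + 1) - 1 = Suc n"
    using p exhaust_4[of p] by (auto simp: n_def)
  let ?A = "\<lambda>n q x. (om q * of_real \<alpha>) ^ n * exp (om q * of_real \<alpha> * of_real x)"
  let ?B = "\<lambda>q x. a * (om q * exp (- (om q * of_real \<alpha>) * of_real x))"
  have A: "(?A n q has_vector_derivative ?A (Suc n) q x) (at x within {-l..l})" for q
    using has_vector_derivative_mult_right[OF has_vector_derivative_exp_mult[of "om q * of_real \<alpha>" x "{-l..l}"],
      of "(om q * of_real \<alpha>) ^ n"] by (simp add: mult_ac)
  have B: "(?B q has_vector_derivative
      a * (om q * (- (om q * of_real \<alpha>) * exp (- (om q * of_real \<alpha>) * of_real x)))) (at x within {-l..l})" for q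
    by (intro has_vector_derivative_mult_right has_vector_derivative_exp_mult)
  have contB: "continuous_on {-l..l} (?B q)" for q
    by (intro continuous_intros)
  have "?A n q x * ?B q x = a * of_real \<alpha> ^ n * om q ^ Suc n" for q
    using exp_mult_exp_neg[of "om q * of_real \<alpha> * of_real x"] by (simp add: power_mult_distrib mult_ac)
  then have "(\<Sum>q\<in>UNIV. ?A n q x * ?B q x) = a * of_real \<alpha> ^ n * (\<Sum>q\<in>UNIV. om q ^ Suc n)"
    by (simp only: sum_distrib_left)
  also have "(\<Sum>q\<in>UNIV. om q ^ Suc n) = 0"
  proof -
    have "n = 0 \<or> n = 1 \<or> n = 2" using n(1) by auto
    then show ?thesis
      using om_power_sums by (auto simp: numeral_2_eq_2 numeral_3_eq_3)
  qed
  finally have zero: "(\<Sum>q\<in>UNIV. ?A n q x * ?B q x) = 0"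
    by simp
  show ?thesis
    using has_vector_derivative_sum_mult_integral[OF x u A B contB zero, of "\<lambda>q. a * (S *v int_vec l \<alpha> u l) $ q"]
    unfolding Wmat_mult_nth coeff_vec_nth n(2) n_def[symmetric] .
qed

lemma has_vector_derivative_coeff_vec:
  assumes u: "integrable (lebesgue_on {-l..l}) u" and x: "x \<in> {-l..l}"
    and uU: "AE x in lebesgue_on {-l..l}. u x = U x" and U: "continuous_on {-l..l} U"
  shows "((\<lambda>x. coeff_vec l \<alpha> S a u x $ q) has_vector_derivative
    - (a * (om q * exp (- (om q * of_real \<alpha>) * of_real x)) * U x)) (at x within {-l..l})"
proof -
  let ?B = "\<lambda>x. a * (om q * exp (- (om q * of_real \<alpha>) * of_real x))"
  have "((\<lambda>x. integral {-l..x} (\<lambda>t. ?B t * U t)) has_vector_derivative ?B x * U x) (at x within {-l..l})"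
    by (rule integral_has_vector_derivative[OF _ x]) (intro continuous_intros U)
  then have "((\<lambda>x. integral {-l..x} (\<lambda>t. ?B t * u t)) has_vector_derivative ?B x * U x) (at x within {-l..l})"
  proof (rule has_vector_derivative_transform[OF x, rotated])
    fix y assume y: "y \<in> {-l..l}"
    have "AE t in lebesgue_on {-l..l}. ?B t * u t = ?B t * U t"
      using uU by eventually_elim simp
    from AE_lebesgue_on_imp_integral_eq[OF this y]
    show "integral {-l..y} (\<lambda>t. ?B t * u t) = integral {-l..y} (\<lambda>t. ?B t * U t)" .
  qed
  then have "((\<lambda>x. a * (S *v int_vec l \<alpha> u l) $ q - integral {-l..x} (\<lambda>t. ?B t * u t))
      has_vector_derivative 0 - ?B x * U x) (at x within {-l..l})"
    by (intro has_vector_derivative_diff) auto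
  then show ?thesis
    unfolding coeff_vec_nth by simp
qed

text \<open>This is h'''' + \<alpha>^4 h = (\<alpha>^4/k) U. At the top order the diagonal term
  survives, and continuity of \<open>U\<close> makes each coefficient differentiable.\<close>

lemma jet_Wmat_coeff_vec:
  fixes l \<alpha> k :: real and S :: "complex^4^4" and u U :: "real \<Rightarrow> complex"
  assumes u: "integrable (lebesgue_on {-l..l}) u"
    and uU: "AE x in lebesgue_on {-l..l}. u x = U x" and U: "continuous_on {-l..l} U"
  defines "D \<equiv> \<lambda>x. Wmat \<alpha> x *v coeff_vec l \<alpha> S (of_real (\<alpha> / (4 * k))) u x"
  shows "jet {-l..l} D (\<lambda>x. of_real (\<alpha> ^ 4 / k) * U x - of_real \<alpha> ^ 4 * D x $ 1)"
proof (rule jetI)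
  fix x assume x: "x \<in> {-l..l}"
  show "((\<lambda>x. D x $ 1) has_vector_derivative D x $ 2) (at x within {-l..l})"
    "((\<lambda>x. D x $ 2) has_vector_derivative D x $ 3) (at x within {-l..l})"
    "((\<lambda>x. D x $ 3) has_vector_derivative D x $ 4) (at x within {-l..l})"
    using has_vector_derivative_Wmat_coeff_vec[OF u x, of 1] has_vector_derivative_Wmat_coeff_vec[OF u x, of 2]
      has_vector_derivative_Wmat_coeff_vec[OF u x, of 3]
    unfolding D_def by simp_all
  define a where "a = complex_of_real (\<alpha> / (4 * k))"
  let ?A = "\<lambda>q x. (om q * of_real \<alpha>) ^ 3 * exp (om q * of_real \<alpha> * of_real x)"
  let ?v = "coeff_vec l \<alpha> S a u"
  have "((\<lambda>x. \<Sum>q\<in>UNIV. ?A q x * ?v x $ q) has_vector_derivative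
     (\<Sum>q\<in>UNIV. ?A q x * - (a * (om q * exp (- (om q * of_real \<alpha>) * of_real x)) * U x) +
       (om q * of_real \<alpha>) ^ 3 * (om q * of_real \<alpha> * exp (om q * of_real \<alpha> * of_real x)) * ?v x $ q)) (at x within {-l..l})"
    by (intro has_vector_derivative_sum has_vector_derivative_mult has_vector_derivative_mult_right
        has_vector_derivative_exp_mult has_vector_derivative_coeff_vec[OF u x uU U])
  moreover have "(\<lambda>x. D x $ 4) = (\<lambda>x. \<Sum>q\<in>UNIV. ?A q x * ?v x $ q)"
    by (simp add: D_def Wmat_mult_nth a_def)
  moreover have "(\<Sum>q\<in>UNIV. ?A q x * - (a * (om q * exp (- (om q * of_real \<alpha>) * of_real x)) * U x) +
       (om q * of_real \<alpha>) ^ 3 * (om q * of_real \<alpha> * exp (om q * of_real \<alpha> * of_real x)) * ?v x $ q) =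
     of_real (\<alpha> ^ 4 / k) * U x - of_real \<alpha> ^ 4 * D x $ 1"
  proof -
    \<comment> \<open>By \<open>om q ^ 4 = -1\<close> each of the four summands contributes
      \<alpha>^3 a U, and 4 \<alpha>^3 a = \<alpha>^4 / k.\<close>
    have "?A q x * - (a * (om q * exp (- (om q * of_real \<alpha>) * of_real x)) * U x) +
       (om q * of_real \<alpha>) ^ 3 * (om q * of_real \<alpha> * exp (om q * of_real \<alpha> * of_real x)) * ?v x $ q =
       om q ^ 4 * of_real \<alpha> ^ 3 * (of_real \<alpha> * (exp (om q * of_real \<alpha> * of_real x) * ?v x $ q)
         - a * U x * (exp (om q * of_real \<alpha> * of_real x) * exp (- (om q * of_real \<alpha> * of_real x))))" for q
      by (simp add: power_mult_distrib power_numeral_reduce algebra_simps)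
    then have "?A q x * - (a * (om q * exp (- (om q * of_real \<alpha>) * of_real x)) * U x) +
       (om q * of_real \<alpha>) ^ 3 * (om q * of_real \<alpha> * exp (om q * of_real \<alpha> * of_real x)) * ?v x $ q =
       of_real \<alpha> ^ 3 * a * U x - of_real \<alpha> ^ 4 * (exp (om q * of_real \<alpha> * of_real x) * ?v x $ q)" for q
      by (simp only: exp_mult_exp_neg om_power4) (simp add: power_numeral_reduce algebra_simps)
    then show ?thesis
      by (simp add: D_def Wmat_mult_nth a_def sum_subtractf sum_distrib_left power_numeral_reduce)
  qed
  ultimately show "((\<lambda>x. D x $ 4) has_vector_derivative of_real (\<alpha> ^ 4 / k) * U x - of_real \<alpha> ^ 4 * D x $ 1)
      (at x within {-l..l})"
    by simp
qed

lemma continuous_on_jet_component: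
  "jet S D F \<Longrightarrow> continuous_on S (\<lambda>x. D x $ p)"
  unfolding jet_def by (rule continuous_on_vector_derivative) blast

lemma continuous_on_Wmat_coeff_vec:
  assumes "integrable (lebesgue_on {-l..l}) u" "p \<noteq> 4"
  shows "continuous_on {-l..l} (\<lambda>x. (Wmat \<alpha> x *v coeff_vec l \<alpha> S a u x) $ p)"
  by (rule continuous_on_vector_derivative[OF has_vector_derivative_Wmat_coeff_vec[OF assms(1) _ assms(2)]])

lemma matrix_vector_mult_minus: "A *v (- x) = - (A *v x)" for A :: "'a::ring_1^'n^'m"
  by (simp add: matrix_vector_mult_def vec_eq_iff sum_negf)

lemma exp_wronskian_inv_Wmat_mult_vec:
  "\<alpha> \<noteq> 0 \<Longrightarrow> exp_wronskian_inv (of_real \<alpha>) x *v (Wmat \<alpha> x *v v) = v"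
  by (simp add: Wmat_eq_exp_wronskian matrix_vector_mul_assoc exp_wronskian_inv_mult_exp_wronskian)

lemma Wmat_exp_wronskian_inv_mult_vec:
  "\<alpha> \<noteq> 0 \<Longrightarrow> Wmat \<alpha> x *v (exp_wronskian_inv (of_real \<alpha>) x *v v) = v"
  by (simp add: Wmat_eq_exp_wronskian matrix_vector_mul_assoc exp_wronskian_mult_exp_wronskian_inv)

text \<open>Together these say v(-l) + S (v(l) - v(-l)) = 0, the boundary condition built into the
  Green's function.\<close>

lemma coeff_vec_endpoints:
  "coeff_vec l \<alpha> S a u (- l) = a *s (S *v int_vec l \<alpha> u l)"
  "coeff_vec l \<alpha> S a u l - coeff_vec l \<alpha> S a u (- l) = - (a *s int_vec l \<alpha> u l)"
proof -
  have "int_vec l \<alpha> u (- l) = 0"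
    by (simp add: int_vec_def vec_eq_iff)
  then show "coeff_vec l \<alpha> S a u (- l) = a *s (S *v int_vec l \<alpha> u l)"
    "coeff_vec l \<alpha> S a u l - coeff_vec l \<alpha> S a u (- l) = - (a *s int_vec l \<alpha> u l)"
    by (simp_all add: coeff_vec_def vec_eq_iff algebra_simps)
qed

section \<open>The eigenvalue equation\<close>

lemma K_op_zero_imp_AE_zero:
  assumes pos: "l > 0" "\<alpha> > 0" "k > 0" and inv: "invertible (Mt l \<alpha> M)" and u: "u \<in> L2_fun l"
    and K: "AE x in lebesgue_on {-l..l}. K_op l \<alpha> k M u x = 0"
  shows "AE x in lebesgue_on {-l..l}. u x = 0"
proof -
  note int = L2_fun_imp_integrable[OF u]
  define V where "V = coeff_vec l \<alpha> (plus_part l \<alpha> M) (of_real (\<alpha> / (4 * k))) u"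
  define D where "D x = Wmat \<alpha> x *v V x" for x
  have deriv: "((\<lambda>x. D x $ p) has_vector_derivative D x $ (p + 1)) (at x within {-l..l})"
    if "x \<in> {-l..l}" "p \<noteq> 4" for x p
    unfolding D_def V_def by (rule has_vector_derivative_Wmat_coeff_vec[OF int that])
  have D1: "D x $ 1 = 0" if "x \<in> {-l..l}" for x
  proof (rule continuous_AE_zero_imp_zero[OF _ _ _ that])
    show "continuous_on {-l..l} (\<lambda>x. D x $ 1)"
      unfolding D_def V_def by (rule continuous_on_Wmat_coeff_vec[OF int]) simp
    show "AE x in lebesgue_on {-l..l}. D x $ 1 = 0"
      using K AE_space by eventually_elim (auto simp: D_def V_def K_op_eq[OF inv int])
  qed (use pos in simp)
  have step: "D x $ (p + 1) = 0" if p: "p \<noteq> 4" and 0: "\<And>x. x \<in> {-l..l} \<Longrightarrow> D x $ p = 0" and x: "x \<in> {-l..l}" for p x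
  proof -
    have "((\<lambda>x. 0) has_vector_derivative D x $ (p + 1)) (at x within {-l..l})"
      by (rule has_vector_derivative_transform[OF x _ deriv[OF x p]]) (simp add: 0)
    then show ?thesis
      using vector_derivative_unique_within_closed_interval[of "-l" l x "\<lambda>_. 0" "D x $ (p + 1)" 0] x pos by simp
  qed
  have D2: "D x $ 2 = 0" if "x \<in> {-l..l}" for x
    using step[of 1 x] D1 that by simp
  have D3: "D x $ 3 = 0" if "x \<in> {-l..l}" for x
    using step[of 2 x] D2 that by simp
  have D4: "D x $ 4 = 0" if "x \<in> {-l..l}" for x
    using step[of 3 x] D3 that by simp
  have V0: "V x = 0" if "x \<in> {-l..l}" for x
  proof -
    have "D x = 0"
      using D1 D2 D3 D4 that by (simp add: vec_eq_iff forall_4)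
    then show ?thesis
      using exp_wronskian_inv_Wmat_mult_vec[of \<alpha> x "V x"] pos by (simp add: D_def)
  qed
  \<comment> \<open>One component is enough, since the factor in front of \<open>u\<close> never
    vanishes. The S term of \<open>V\<close> is constant in x and drops out of V x - V (-
    l).\<close>
  let ?f = "\<lambda>t. om 1 * exp (- (om 1 * of_real \<alpha> * of_real t)) * u t"
  have "integral {-l..x} ?f = 0" if "x \<in> {-l..l}" for x
  proof -
    have "V x $ 1 - V (- l) $ 1 = - of_real (\<alpha> / (4 * k)) * integral {-l..x} ?f"
      by (simp add: V_def coeff_vec_def int_vec_def algebra_simps)
    then show ?thesis
      using V0[OF that] V0[of "-l"] pos by simp
  qed
  moreover have "?f absolutely_integrable_on {-l..l}"
    by (intro integrable_lebesgue_on_imp_absolutely_integrable integrable_continuous_mult int continuous_intros)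
  ultimately have "AE t in lebesgue_on {-l..l}. ?f t = 0"
    by (intro integrals_zero_imp_AE_zero)
  then show ?thesis
    by eventually_elim (simp del: pos_simps)
qed

text \<open>h / lam is a continuous representative of u; inserting it closes the equation for the
  jet of h, so this jet is W_lam c. The boundary condition passes from v to e = v / lam.\<close>

lemma K_op_eigenfunction_imp:
  fixes k :: real
  assumes pos: "l > 0" "\<alpha> > 0" "k > 0" and inv: "invertible (Mt l \<alpha> M)" and u: "u \<in> L2_fun l"
    and lam: "lam \<noteq> 0" and K: "AE x in lebesgue_on {-l..l}. K_op l \<alpha> k M u x = lam * u x"
  defines "e \<equiv> \<lambda>c x. exp_wronskian_inv (of_real \<alpha>) x *v (Wl \<alpha> k lam x *v c)"
  shows "\<exists>c. (AE x in lebesgue_on {-l..l}. u x = tdot (ylvec \<alpha> k lam x) c) \<and>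
    e c (- l) + plus_part l \<alpha> M *v (e c l - e c (- l)) = 0"
proof -
  note int = L2_fun_imp_integrable[OF u]
  let ?a = "complex_of_real (\<alpha> / (4 * k))"
  define V where "V = coeff_vec l \<alpha> (plus_part l \<alpha> M) ?a u"
  define D where "D x = Wmat \<alpha> x *v V x" for x
  define U where "U x = D x $ 1 / lam" for x
  have uU: "AE x in lebesgue_on {-l..l}. u x = U x"
    using K AE_space by eventually_elim (use lam in \<open>auto simp: D_def V_def U_def K_op_eq[OF inv int]\<close>)
  have "continuous_on {-l..l} U"
    unfolding U_def D_def V_def
    by (intro continuous_intros continuous_on_Wmat_coeff_vec[OF int]) (use lam in auto)
  from jet_Wmat_coeff_vec[OF int uU this, of \<alpha> "plus_part l \<alpha> M" k]
  have "jet {-l..l} D (\<lambda>x. of_real (\<alpha> ^ 4 / k) * U x - of_real \<alpha> ^ 4 * D x $ 1)"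
    unfolding D_def V_def .
  moreover have "of_real (\<alpha> ^ 4 / k) * U x - of_real \<alpha> ^ 4 * D x $ 1 =
      (1 / (lam * of_real k) - 1) * of_real \<alpha> ^ 4 * D x $ 1" for x
    using pos lam by (simp add: U_def field_simps)
  ultimately have "jet {-l..l} D (\<lambda>x. (1 / (lam * of_real k) - 1) * of_real \<alpha> ^ 4 * D x $ 1)"
    by simp
  from jet_eq_Wl[OF lam _ _ this] pos
  obtain c where c: "\<And>x. x \<in> {-l..l} \<Longrightarrow> D x = Wl \<alpha> k lam x *v c"
    by auto
  \<comment> \<open>\<open>D\<close> is the jet of h = lam u, so the coefficients of u itself carry
    the factor 1 / lam.\<close>
  define d where "d = (1 / lam) *s c"
  have d: "Wl \<alpha> k lam x *v d = (1 / lam) *s D x" if "x \<in> {-l..l}" for x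
    by (simp add: d_def c[OF that] vector_scalar_commute)
  have "AE x in lebesgue_on {-l..l}. u x = tdot (ylvec \<alpha> k lam x) d"
    using uU AE_space by eventually_elim (auto simp: tdot_ylvec d U_def)
  moreover have "e d x = (1 / lam) *s V x" if "x \<in> {-l..l}" for x
    using pos by (simp add: e_def d[OF that] vector_scalar_commute D_def exp_wronskian_inv_Wmat_mult_vec)
  then have ed: "e d (- l) = (1 / lam) *s V (- l)" "e d l - e d (- l) = (1 / lam) *s (V l - V (- l))"
    using pos by (simp_all add: vector_sub_rdistrib)
  have "e d (- l) + plus_part l \<alpha> M *v (e d l - e d (- l)) = 0"
    unfolding ed(2) unfolding ed(1) V_def coeff_vec_endpoints(2) unfolding coeff_vec_endpoints(1)
    by (simp add: vector_scalar_commute matrix_vector_mult_minus)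
  ultimately show ?thesis by blast
qed

lemma K_op_eigenfunctionI:
  fixes k :: real
  assumes pos: "l > 0" "\<alpha> > 0" "k > 0" and inv: "invertible (Mt l \<alpha> M)" and u: "u \<in> L2_fun l"
    and lam: "lam \<noteq> 0" and uc: "AE x in lebesgue_on {-l..l}. u x = tdot (ylvec \<alpha> k lam x) c"
  defines "e \<equiv> \<lambda>x. exp_wronskian_inv (of_real \<alpha>) x *v (Wl \<alpha> k lam x *v c)"
  assumes bc: "e (- l) + plus_part l \<alpha> M *v (e l - e (- l)) = 0"
  shows "AE x in lebesgue_on {-l..l}. K_op l \<alpha> k M u x = lam * u x"
proof -
  note int = L2_fun_imp_integrable[OF u]
  let ?a = "complex_of_real (\<alpha> / (4 * k))"
  define V where "V = coeff_vec l \<alpha> (plus_part l \<alpha> M) ?a u"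
  define U where "U x = (Wl \<alpha> k lam x *v c) $ 1" for x
  have jet: "jet {-l..l} (\<lambda>x. Wl \<alpha> k lam x *v c) (\<lambda>x. (1 / (lam * of_real k) - 1) * of_real \<alpha> ^ 4 * U x)"
    unfolding U_def by (rule jet_Wl) (use lam pos in auto)
  have uU: "AE x in lebesgue_on {-l..l}. u x = U x"
    using uc by (simp add: U_def tdot_ylvec)
  have U: "continuous_on {-l..l} U"
    unfolding U_def by (rule continuous_on_jet_component[OF jet])
  have "((\<lambda>x. lam * e x $ q - V x $ q) has_vector_derivative 0) (at x within {-l..l})"
    if x: "x \<in> {-l..l}" for x q
  proof -
    have "((\<lambda>x. e x $ q) has_vector_derivative exp (- (om q * of_real \<alpha> * of_real x)) / (4 * (om q * of_real \<alpha>) ^ 3) *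
        ((1 / (lam * of_real k) - 1) * of_real \<alpha> ^ 4 * U x + of_real \<alpha> ^ 4 * U x)) (at x within {-l..l})"
      using has_vector_derivative_exp_wronskian_inv_jet[OF jet x, of "of_real \<alpha>" q] pos unfolding e_def U_def by simp
    moreover have "exp (- (om q * of_real \<alpha> * of_real x)) / (4 * (om q * of_real \<alpha>) ^ 3) *
        ((1 / (lam * of_real k) - 1) * of_real \<alpha> ^ 4 * U x + of_real \<alpha> ^ 4 * U x) =
        - (?a / lam * om q * exp (- (om q * of_real \<alpha> * of_real x)) * U x)"
    proof -
      define X where "X = (om q * of_real \<alpha>) ^ 3"
      \<comment> \<open>Replacing 1 / om q ^ 3 by - om q turns the factor from variation of
        constants into the integrand of \<open>coeff_vec\<close>.\<close>
      have "X * om q = - (of_real \<alpha> ^ 3)"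
        using om_power4[of q] by (simp add: X_def power_mult_distrib power_numeral_reduce mult_ac)
      moreover have "X \<noteq> 0"
        using pos by (simp add: X_def)
      ultimately have "1 / X = - (om q / of_real \<alpha> ^ 3)"
        using pos by (simp add: field_simps)
      then have "exp (- (om q * of_real \<alpha> * of_real x)) * (1 / X) / 4 =
        - (om q * exp (- (om q * of_real \<alpha> * of_real x)) / (4 * of_real \<alpha> ^ 3))"
        by (simp only:) (simp add: mult.commute)
      then have "exp (- (om q * of_real \<alpha> * of_real x)) / (4 * (om q * of_real \<alpha>) ^ 3) =
        - (om q * exp (- (om q * of_real \<alpha> * of_real x)) / (4 * of_real \<alpha> ^ 3))"
        by (simp add: X_def mult.commute)
      moreover have "(1 / (lam * of_real k) - 1) * of_real \<alpha> ^ 4 * U x + of_real \<alpha> ^ 4 * U x =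
          of_real \<alpha> ^ 4 / (lam * of_real k) * U x"
        by (simp add: algebra_simps)
      ultimately show ?thesis
        by (simp only:) (use pos lam in \<open>simp add: field_simps power_numeral_reduce\<close>)
    qed
    ultimately have "((\<lambda>x. lam * e x $ q) has_vector_derivative
        lam * - (?a / lam * om q * exp (- (om q * of_real \<alpha> * of_real x)) * U x)) (at x within {-l..l})"
      by (intro has_vector_derivative_mult_right) simp
    from has_vector_derivative_diff[OF this has_vector_derivative_coeff_vec[OF int x uU U, of \<alpha> "plus_part l \<alpha> M" ?a q]]
    show ?thesis
      using lam by (simp add: V_def)
  qed
  then have "\<forall>q. \<exists>r. \<forall>x\<in>{-l..l}. lam * e x $ q - V x $ q = r"
    by (intro allI zero_derivative_imp_constant)
  then obtain r where r: "\<And>x q. x \<in> {-l..l} \<Longrightarrow> lam * e x $ q - V x $ q = r q"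
    by metis
  define w where "w = (\<chi> q. r q)"
  have w: "lam *s e x = V x + w" if "x \<in> {-l..l}" for x
    using r[OF that] by (simp add: vec_eq_iff w_def algebra_simps)
  \<comment> \<open>The constant \<open>w\<close> cancels in the difference and survives once
    outside. The boundary expressions of \<open>e\<close> and \<open>V\<close> are both 0, so
    \<open>w = 0\<close>.\<close>
  have "lam *s (e (- l) + plus_part l \<alpha> M *v (e l - e (- l))) =
      (V (- l) + w) + plus_part l \<alpha> M *v (V l - V (- l))"
  proof -
    have wl: "lam *s e (- l) = V (- l) + w"
      using w[of "- l"] pos by simp
    have "lam *s (e l - e (- l)) = V l - V (- l)"
      using w[of l] wl pos by (simp add: vector_sub_rdistrib)
    with wl show ?thesis
      by (simp only: vector_add_ldistrib flip: vector_scalar_commute)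
  qed
  then have "w = 0"
    unfolding bc unfolding V_def coeff_vec_endpoints(2) unfolding coeff_vec_endpoints(1)
    by (simp add: vector_scalar_commute matrix_vector_mult_minus)
  then have "V x = lam *s e x" if "x \<in> {-l..l}" for x
    using w[OF that] by simp
  then have "Wmat \<alpha> x *v V x = lam *s (Wl \<alpha> k lam x *v c)" if "x \<in> {-l..l}" for x
    using that pos by (simp add: e_def vector_scalar_commute Wmat_exp_wronskian_inv_mult_vec)
  then have "K_op l \<alpha> k M u x = lam * U x" if "x \<in> {-l..l}" for x
    unfolding K_op_eq[OF inv int that] U_def V_def[symmetric] using that by simp
  then show ?thesis
    using uU AE_space by (auto elim!: eventually_elim2)
qed

lemma K_op_eigenfunction_iff:
  assumes "l > 0" "\<alpha> > 0" "k > 0" "invertible (Mt l \<alpha> M)" "u \<in> L2_fun l"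
    and nz: "\<not> (AE x in lebesgue_on {-l..l}. u x = 0)"
  shows "(AE x in lebesgue_on {-l..l}. K_op l \<alpha> k M u x = lam * u x) \<longleftrightarrow>
    lam \<noteq> 0 \<and> (\<exists>c. c \<noteq> 0 \<and> (AE x in lebesgue_on {-l..l}. u x = tdot (ylvec \<alpha> k lam x) c) \<and>
      (Gmat l \<alpha> M ** (Xl \<alpha> k lam l - Xl \<alpha> k lam (-l)) + Xl \<alpha> k lam l) *v c = 0)"
    (is "?K \<longleftrightarrow> ?R")
proof
  assume K: ?K
  have lam: "lam \<noteq> 0"
    using K K_op_zero_imp_AE_zero[OF assms(1-5)] nz by auto
  from K_op_eigenfunction_imp[OF assms(1-5) lam K]
  obtain c where c: "AE x in lebesgue_on {-l..l}. u x = tdot (ylvec \<alpha> k lam x) c"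
    "(Gmat l \<alpha> M ** (Xl \<alpha> k lam l - Xl \<alpha> k lam (-l)) + Xl \<alpha> k lam l) *v c = 0"
    unfolding boundary_condition_eq[OF assms(2)] by blast
  \<comment> \<open>\<open>c = 0\<close> would make \<open>u\<close> vanish almost
    everywhere.\<close>
  moreover have "c \<noteq> 0"
    using nz c(1) by (auto simp: tdot_def)
  ultimately show ?R
    using lam by blast
next
  assume ?R
  then show ?K
    unfolding boundary_condition_eq[OF assms(2)] using K_op_eigenfunctionI[OF assms(1-5)] by blast
qed

theorem theorem1:
  fixes l \<alpha> k :: real
    and M :: "complex^(4 + 4)^4"
    and u :: "real \<Rightarrow> complex"
    and lam :: complex
  assumes "l > 0" and "\<alpha> > 0" and "k > 0"
    and "well_posed l \<alpha> M"
    and "u \<in> L2_fun l"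
    and "\<not> (AE x in lebesgue_on {-l..l}. u x = 0)"
  shows "((AE x in lebesgue_on {-l..l}. K_op l \<alpha> k M u x = lam * u x) \<longleftrightarrow>
            lam \<noteq> 0 \<and>
            (\<exists>c :: complex^4. c \<noteq> 0 \<and>
               (AE x in lebesgue_on {-l..l}. u x = tdot (ylvec \<alpha> k lam x) c) \<and>
               (Gmat l \<alpha> M ** (Xl \<alpha> k lam l - Xl \<alpha> k lam (-l)) + Xl \<alpha> k lam l) *v c = 0)) \<and>
         ((AE x in lebesgue_on {-l..l}. K_op l \<alpha> k (Qmat \<alpha>) u x = lam * u x) \<longleftrightarrow>
            lam \<noteq> 0 \<and>
            (\<exists>c :: complex^4. c \<noteq> 0 \<and>
               (AE x in lebesgue_on {-l..l}. u x = tdot (ylvec \<alpha> k lam x) c) \<and>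
               Xl \<alpha> k lam l *v c = 0))"
  \<comment> \<open>The second equivalence is the first for the matrix Q, where \<open>Gmat\<close>
    is 0 and only X(l) c remains.\<close>
  using K_op_eigenfunction_iff[OF assms(1-3) well_posed_imp_invertible_Mt[OF assms(1,2,4)] assms(5,6), of lam]
    K_op_eigenfunction_iff[OF assms(1-3) invertible_Mt_Q[OF assms(2)] assms(5,6), of lam]
  by (simp add: Gmat_Q)

end
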